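(* Let $\mathbf P$ be an irreducible $s\times s$ stochastic matrix, let $\mathbf a\in\mathbb R^{1\times s}$ be a fixed initial (probability) row vector, $\mathbf c\in\mathbb R^{s\times1}$ fixed, $m\ge0$ an integer, and define $$\Gamma_m(\mathbf P;\mathbf a,\mathbf c)=\big(\mathbf a\mathbf P^0\mathbf c,\mathbf a\mathbf P^1\mathbf c,\ldots,\mathbf a\mathbf P^m\mathbf c\big)^\top.$$ With $\widehat{\mathbf P}(n)$ the maximum likelihood estimator of $\mathbf P$, the plug-in estimator $\Gamma_m(\widehat{\mathbf P}(n);\mathbf a,\mathbf c)$ is strongly consistent for $\Gamma_m(\mathbf P;\mathbf a,\mathbf c)$ and $$\sqrt n\{\Gamma_m(\widehat{\mathbf P}(n);\mathbf a,\mathbf c)-\Gamma_m(\mathbf P;\mathbf a,\mathbf c)\}\xrightarrow{d}\mathbf Z_m,$$ where $\mathbf Z_m=(Z_{m,0},\ldots,Z_{m,m})^\top$, $Z_{m,k}=\mathbf a\mathbf W_{\mathbf P^k}\mathbf c$, $k=0,\ldots,m$. The covariance matrix of $\mathbf Z_m$ is given by $$\operatorname{Cov}(Z_{m,k},Z_{m,\ell})=(\mathbf a\otimes\mathbf c^\top)\mathbf M_k\mathbf\Sigma_{\mathbf p}\mathbf M_\ell^\top(\mathbf a^\top\otimes\mathbf c),\qquad k,\ell=0,\ldots,m.$$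
   Context: $(X_m)_{m\ge0}$ is a time-homogeneous Markov chain on $\{1,\ldots,s\}$ with irreducible transition matrix $\mathbf P=(p_{ij})$ and stationary row vector $\boldsymbol\pi=(\pi_1,\ldots,\pi_s)$, observed along a single trajectory $X_0,\ldots,X_n$. $N_{ij}(n)$ is the number of transitions from $i$ to $j$ up to time $n$, $N_i(n)=\sum_jN_{ij}(n)$, and $\widehat{\mathbf P}(n)$ has entries $N_{ij}(n)/N_i(n)$ (and $0$ if $N_i(n)=0$). Limits are as $n\to\infty$; $\xrightarrow{d}$ is convergence in distribution; strongly consistent means almost surely convergent to the true value. $\mathbf W=(W_{ij})$ is the centered Gaussian random $s\times s$ matrix with $\operatorname{Cov}(W_{ij},W_{kl})=\delta_{ik}\pi_i^{-1}p_{ij}(\delta_{jl}-p_{il})$. For $k\ge1$, $\mathbf W_{\mathbf P^k}=\sum_{i=0}^{k-1}\mathbf P^i\mathbf W\mathbf P^{k-1-i}$ and $\mathbf M_k=\sum_{i=0}^{k-1}\mathbf P^i\otimes(\mathbf P^{k-1-i})^\top$; also $\mathbf W_{\mathbf P^0}=\mathbf 0_{s\times s}$ and $\mathbf M_0=\mathbf 0_{s^2\times s^2}$. $\mathbf\Sigma_{\mathbf p}=\operatorname{Cov}(\operatorname{vec}(\mathbf W^\top))$ ($\operatorname{vec}$ stacks columns), i.e. the block diagonal matrix with blocks $\pi_i^{-1}\mathbf\Lambda_i$, $\mathbf\Lambda_i(j,k)=p_{ij}(\delta_{jk}-p_{ik})$. $\otimes$ is the Kronecker product. *)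

theory Defs
  imports "HOL-Probability.Probability"
begin

text \<open>The state space \<open>{1,\<dots>,s}\<close> is a type \<open>'s::finite\<close>, so \<open>s = CARD('s)\<close>. Row and column vectors
  are both elements of \<^typ>\<open>real^'s\<close>: a row vector acts by \<open>v*\<close>, a column vector by \<open>*v\<close>.
  Matrices of order \<open>s\<^sup>2\<close> are indexed by \<^typ>\<open>'s \<times> 's\<close>; under the lexicographic numbering
  \<open>(i, j) \<mapsto> (i - 1) s + j\<close> of the pairs, the Kronecker products and \<open>vec\<close> below are the usual ones.\<close>

subsection \<open>Matrices\<close>

text \<open>\<open>P ^ k\<close> cannot be used for matrix powers: multiplication on \<^typ>\<open>real^'s^'s\<close> is entrywise.\<close>

primrec matpow :: "real^'s^'s \<Rightarrow> nat \<Rightarrow> real^'s^'s" where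
  "matpow A 0 = mat 1"
| "matpow A (Suc k) = matpow A k ** A"

definition kron :: "real^'s^'s \<Rightarrow> real^'s^'s \<Rightarrow> real^('s \<times> 's)^('s \<times> 's)" where
  "kron A B = (\<chi> p q. A $ fst p $ fst q * B $ snd p $ snd q)"

text \<open>The entries of \<open>a \<otimes> c\<^sup>T\<close> (a row, for a row \<open>a\<close> and a column \<open>c\<close>) and equally of
  \<open>a\<^sup>T \<otimes> c\<close> (a column).\<close>

definition kron_vec :: "real^'s \<Rightarrow> real^'s \<Rightarrow> real^('s \<times> 's)" where
  "kron_vec a c = (\<chi> p. a $ fst p * c $ snd p)"

text \<open>Column stacking: \<open>(j, i)\<close> is the position of row \<open>i\<close> within column \<open>j\<close>.\<close>

definition vec_mat :: "real^'s^'s \<Rightarrow> real^('s \<times> 's)" where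
  "vec_mat A = (\<chi> p. A $ snd p $ fst p)"

definition prob_vector :: "real^'s \<Rightarrow> bool" where
  "prob_vector v \<longleftrightarrow> (\<forall>i. 0 \<le> v $ i) \<and> (\<Sum>i\<in>UNIV. v $ i) = 1"

definition stochastic :: "real^'s^'s \<Rightarrow> bool" where
  "stochastic P \<longleftrightarrow> (\<forall>i. prob_vector (P $ i))"

definition irreducible_mat :: "real^'s^'s \<Rightarrow> bool" where
  "irreducible_mat P \<longleftrightarrow> (\<forall>i j. \<exists>n\<ge>1. 0 < matpow P n $ i $ j)"

definition stationary :: "real^'s^'s \<Rightarrow> real^'s \<Rightarrow> bool" where
  "stationary P \<pi> \<longleftrightarrow> prob_vector \<pi> \<and> \<pi> v* P = \<pi>"

subsection \<open>Markov chains and the empirical transition matrix\<close>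

text \<open>The initial distribution of the chain is arbitrary.\<close>

definition markov_chain :: "'a measure \<Rightarrow> (nat \<Rightarrow> 'a \<Rightarrow> 's) \<Rightarrow> real^'s^'s \<Rightarrow> bool" where
  "markov_chain M X P \<longleftrightarrow>
     prob_space M \<and> (\<forall>n. X n \<in> measurable M (count_space UNIV)) \<and>
     (\<forall>n x. \<P>(\<omega> in M. \<forall>t\<le>n. X t \<omega> = x t) > 0 \<longrightarrow>
        \<P>(\<omega> in M. X (Suc n) \<omega> = x (Suc n) \<bar> \<forall>t\<le>n. X t \<omega> = x t) = P $ x n $ x (Suc n))"

definition trans_count :: "(nat \<Rightarrow> 'a \<Rightarrow> 's) \<Rightarrow> nat \<Rightarrow> 'a \<Rightarrow> 's \<Rightarrow> 's \<Rightarrow> nat" where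
  "trans_count X n \<omega> i j = card {t. t < n \<and> X t \<omega> = i \<and> X (Suc t) \<omega> = j}"

definition visit_count :: "(nat \<Rightarrow> 'a \<Rightarrow> 's::finite) \<Rightarrow> nat \<Rightarrow> 'a \<Rightarrow> 's \<Rightarrow> nat" where
  "visit_count X n \<omega> i = (\<Sum>j\<in>UNIV. trans_count X n \<omega> i j)"

definition P_hat :: "(nat \<Rightarrow> 'a \<Rightarrow> 's) \<Rightarrow> nat \<Rightarrow> 'a \<Rightarrow> real^'s^'s" where
  "P_hat X n \<omega> = (\<chi> i j. if visit_count X n \<omega> i = 0 then 0
     else real (trans_count X n \<omega> i j) / real (visit_count X n \<omega> i))"

subsection \<open>Gaussian vectors, covariance, convergence in distribution\<close>

definition covariance :: "'b measure \<Rightarrow> ('b \<Rightarrow> real) \<Rightarrow> ('b \<Rightarrow> real) \<Rightarrow> real" where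
  "covariance N f g =
     (\<integral>\<omega>. (f \<omega> - (\<integral>\<omega>'. f \<omega>' \<partial>N)) * (g \<omega> - (\<integral>\<omega>'. g \<omega>' \<partial>N)) \<partial>N)"

text \<open>Normal law with mean \<open>\<mu>\<close> and standard deviation \<open>\<sigma>\<close>; \<open>\<sigma> = 0\<close> gives the point mass,
  which must be allowed because the covariance matrices considered here are singular.\<close>

definition normal_law :: "real \<Rightarrow> real \<Rightarrow> real measure" where
  "normal_law \<mu> \<sigma> =
     (if \<sigma> = 0 then return borel \<mu> else density lborel (normal_density \<mu> \<sigma>))"

definition gaussian :: "'b measure \<Rightarrow> ('b \<Rightarrow> 'e::euclidean_space) \<Rightarrow> bool" where
  "gaussian N Y \<longleftrightarrow> prob_space N \<and> Y \<in> borel_measurable N \<and>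
     (\<forall>u. \<exists>\<mu> \<sigma>. 0 \<le> \<sigma> \<and> distr N borel (\<lambda>\<omega>. u \<bullet> Y \<omega>) = normal_law \<mu> \<sigma>)"

text \<open>Random vectors in \<open>\<real>\<^sup>I\<close>, for a finite index set \<open>I\<close>, are functions in \<open>I \<rightarrow>\<^sub>E \<real>\<close>.\<close>

definition conv_in_distribution ::
  "'i set \<Rightarrow> 'a measure \<Rightarrow> (nat \<Rightarrow> 'a \<Rightarrow> 'i \<Rightarrow> real) \<Rightarrow> 'b measure \<Rightarrow> ('b \<Rightarrow> 'i \<Rightarrow> real) \<Rightarrow> bool"
where
  "conv_in_distribution I M Y N Z \<longleftrightarrow>
     (\<forall>n. Y n \<in> measurable M (\<Pi>\<^sub>M i\<in>I. borel)) \<and> Z \<in> measurable N (\<Pi>\<^sub>M i\<in>I. borel) \<and>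
     (\<forall>f. continuous_map (powertop_real I) euclideanreal f \<and>
          bounded (f ` topspace (powertop_real I)) \<longrightarrow>
          (\<lambda>n. \<integral>\<omega>. f (Y n \<omega>) \<partial>M) \<longlonglongrightarrow> (\<integral>\<omega>. f (Z \<omega>) \<partial>N))"

subsection \<open>The functional and its limit\<close>

definition Gam :: "nat \<Rightarrow> real^'s^'s \<Rightarrow> real^'s \<Rightarrow> real^'s \<Rightarrow> nat \<Rightarrow> real" where
  "Gam m P a c = (\<lambda>k\<in>{..m}. (a v* matpow P k) \<bullet> c)"

definition W_pow :: "real^'s^'s \<Rightarrow> real^'s^'s \<Rightarrow> nat \<Rightarrow> real^'s^'s" where
  "W_pow P W k = (\<Sum>i<k. matpow P i ** W ** matpow P (k - 1 - i))"

definition Z_vec ::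
  "nat \<Rightarrow> real^'s^'s \<Rightarrow> real^'s \<Rightarrow> real^'s \<Rightarrow> real^'s^'s \<Rightarrow> nat \<Rightarrow> real" where
  "Z_vec m P a c W = (\<lambda>k\<in>{..m}. (a v* W_pow P W k) \<bullet> c)"

definition M_mat :: "real^'s^'s \<Rightarrow> nat \<Rightarrow> real^('s \<times> 's)^('s \<times> 's)" where
  "M_mat P k = (\<Sum>i<k. kron (matpow P i) (transpose (matpow P (k - 1 - i))))"

definition Lambda :: "real^'s^'s \<Rightarrow> 's \<Rightarrow> real^'s^'s" where
  "Lambda P i = (\<chi> j k. P $ i $ j * (of_bool (j = k) - P $ i $ k))"

definition Sigma_p :: "real^'s^'s \<Rightarrow> real^'s \<Rightarrow> real^('s \<times> 's)^('s \<times> 's)" where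
  "Sigma_p P \<pi> = (\<chi> p q. if fst p = fst q
     then inverse (\<pi> $ fst p) * Lambda P (fst p) $ snd p $ snd q else 0)"

definition is_W :: "real^'s^'s \<Rightarrow> real^'s \<Rightarrow> 'b measure \<Rightarrow> ('b \<Rightarrow> real^'s^'s) \<Rightarrow> bool" where
  "is_W P \<pi> N W \<longleftrightarrow> gaussian N W \<and>
     (\<forall>i j. (\<integral>\<omega>. W \<omega> $ i $ j \<partial>N) = 0) \<and>
     (\<forall>i j k l. covariance N (\<lambda>\<omega>. W \<omega> $ i $ j) (\<lambda>\<omega>. W \<omega> $ k $ l) =
        of_bool (i = k) * inverse (\<pi> $ i) * P $ i $ j * (of_bool (j = l) - P $ i $ l))"

lemma Sigma_p_eq_covariance:
  assumes "is_W P \<pi> N W"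
  shows "Sigma_p P \<pi> = (\<chi> p q. covariance N (\<lambda>\<omega>. vec_mat (transpose (W \<omega>)) $ p)
                                            (\<lambda>\<omega>. vec_mat (transpose (W \<omega>)) $ q))"
  using assms
  by (simp add: is_W_def vec_mat_def transpose_def Sigma_p_def Lambda_def vec_eq_iff)

lemma vec_mat_mult_eq_kron:
  "vec_mat (A ** B ** C) = kron (transpose C) A *v vec_mat B"
proof -
  have "(\<Sum>k\<in>UNIV. (\<Sum>l\<in>UNIV. A $ i $ l * B $ l $ k) * C $ k $ j) =
    (\<Sum>p\<in>UNIV. C $ fst p $ j * A $ i $ snd p * B $ snd p $ fst p)" for i j
    by (simp add: UNIV_Times_UNIV[symmetric] sum.cartesian_product' sum_distrib_right sum_distrib_left mult_ac
        del: UNIV_Times_UNIV)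
  then show ?thesis
    by (simp add: vec_eq_iff vec_mat_def kron_def transpose_def matrix_matrix_mult_def
        matrix_vector_mult_def)
qed

end

theory Submission
  imports Defs
begin

text \<open>The error of the estimator is an exact function of a martingale. With \<open>N\<^sub>i\<close> and \<open>N\<^sub>i\<^sub>j\<close> the numbers of visits and
  of transitions up to time \<open>n\<close>, the array \<open>S\<^sub>i\<^sub>j = N\<^sub>i\<^sub>j - p\<^sub>i\<^sub>j N\<^sub>i\<close> is a sum of bounded martingale
  differences, the entries of the estimation error are \<open>S\<^sub>i\<^sub>j / N\<^sub>i\<close>, and the telescoping identity
  \<open>A\<^sup>k - P\<^sup>k = (\<Sum>i<k. A\<^sup>i (A - P) P\<^sup>k\<^sup>-\<^sup>1\<^sup>-\<^sup>i)\<close> turns the error of the matrix into the error of the functional.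
  So the scaled error of the functional is a fixed continuous function (\<open>delta_map\<close>) of the estimated
  matrix, of the ratios \<open>n / N\<^sub>i\<close> and of \<open>S / \<surd>n\<close> (\<open>score\<close>), linear in the last one. If the first
  two converge almost surely to constants and the third in law, the limit law is
  obtained by substitution (\<open>slutsky\<close>).

  Almost sure convergence. The second moment of a martingale with bounded differences grows linearly, which
  along the squares \<open>n = k\<^sup>2\<close> is enough for a strong law, and the gaps between squares are too
  short to matter (\<open>transition_sum_strong_law\<close>). Applied to the indicator of the next state it says that the
  empirical distribution \<open>v\<close> of the chain satisfies \<open>v P - v \<rightarrow> 0\<close>. Irreducibility makes the linear map
  \<open>v \<mapsto> (v P - v, \<Sum>\<^sub>i v\<^sub>i)\<close> injective, hence \<open>v \<rightarrow> \<pi>\<close> (\<open>asymptotically_stationary_limit\<close>).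

  Convergence in law. For one linear combination of the entries of \<open>S\<close> the characteristic function is computed by
  McLeish's device: write \<open>e\<^sup>i\<^sup>x = (1 + i x) \<sqdot> corrector x\<close>. The product of the factors \<open>1 + i x\<close>
  is a bounded martingale of mean one, while the product of the correctors converges almost surely to the constant
  \<open>exp (- \<sigma>\<^sup>2 / 2)\<close>, with \<open>\<sigma>\<^sup>2\<close> the asymptotic variance, by the ergodic theorem for the squares of the differences (\<open>transition_sum_char_limit\<close>).
  The passage from linear combinations to vectors is \<open>levy_cramer_wold\<close>: on a
  large cube, every bounded continuous function is close to a trigonometric sum that stays
  bounded off the cube. The Gaussian matrix \<open>W\<close> enters only through the laws and the second moments of its linear
  functionals, and these also give the covariance of the limit, since \<open>a W\<^bsub>P^k\<^esub> c\<close> is the inner product of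
  the row \<open>(a \<otimes> c\<^sup>T) M\<^sub>k\<close> with \<open>vec W\<^sup>T\<close>.\<close>

section \<open>Weak convergence from trigonometric test functions\<close>

text \<open>The test functions for which the limits are known from characteristic functions. The phase
  \<open>b\<close> makes sines and constants special cases and the set closed under products.\<close>

inductive_set trig_sums :: "('e::euclidean_space \<Rightarrow> real) set" where
  wave: "(\<lambda>x. r * cos (u \<bullet> x + b)) \<in> trig_sums"
| add: "f \<in> trig_sums \<Longrightarrow> g \<in> trig_sums \<Longrightarrow> (\<lambda>x. f x + g x) \<in> trig_sums"

lemma trig_sums_mult:
  assumes "f \<in> trig_sums" "g \<in> trig_sums"
  shows "(\<lambda>x. f x * g x) \<in> trig_sums"
  using assms(1)
proof induction
  case (wave r u b)
  show ?case using assms(2)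
  proof induction
    case (wave r' u' b')
    have "(\<lambda>x. r * cos (u \<bullet> x + b) * (r' * cos (u' \<bullet> x + b'))) =
      (\<lambda>x. (r * r' / 2) * cos ((u - u') \<bullet> x + (b - b')) + (r * r' / 2) * cos ((u + u') \<bullet> x + (b + b')))"
    proof
      fix x
      have "cos (u \<bullet> x + b) * cos (u' \<bullet> x + b') =
        (cos ((u \<bullet> x + b) - (u' \<bullet> x + b')) + cos ((u \<bullet> x + b) + (u' \<bullet> x + b'))) / 2"
        by (rule cos_times_cos)
      also have "\<dots> = (cos ((u - u') \<bullet> x + (b - b')) + cos ((u + u') \<bullet> x + (b + b'))) / 2"
        by (simp add: inner_diff_left inner_add_left algebra_simps)
      finally have *: "cos (u \<bullet> x + b) * cos (u' \<bullet> x + b') =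
        (cos ((u - u') \<bullet> x + (b - b')) + cos ((u + u') \<bullet> x + (b + b'))) / 2" .
      have "r * cos (u \<bullet> x + b) * (r' * cos (u' \<bullet> x + b')) = (r * r') * (cos (u \<bullet> x + b) * cos (u' \<bullet> x + b'))"
        by (simp add: mult_ac)
      also note *
      finally show "r * cos (u \<bullet> x + b) * (r' * cos (u' \<bullet> x + b')) =
        (r * r' / 2) * cos ((u - u') \<bullet> x + (b - b')) + (r * r' / 2) * cos ((u + u') \<bullet> x + (b + b'))"
        by (simp add: field_simps)
    qed
    then show ?case by (simp only: trig_sums.intros)
  next
    case (add f g)
    then show ?case by (simp add: distrib_left trig_sums.add)
  qed
next
  case (add f1 f2)
  then show ?case by (simp add: distrib_right trig_sums.add)
qed

lemma trig_sums_const: "(\<lambda>x. r) \<in> trig_sums"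
  using trig_sums.wave[of r 0 0] by simp

lemma trig_sums_sum: "finite A \<Longrightarrow> (\<And>i. i \<in> A \<Longrightarrow> f i \<in> trig_sums) \<Longrightarrow> (\<lambda>x. \<Sum>i\<in>A. f i x) \<in> trig_sums"
  by (induction A rule: finite_induct) (auto intro: trig_sums_const trig_sums.add)

definition coordwise :: "(real \<Rightarrow> real) \<Rightarrow> 'e::euclidean_space \<Rightarrow> 'e" where
  "coordwise g x = (\<Sum>i\<in>Basis. g (x \<bullet> i) *\<^sub>R i)"

lemma coordwise_inner [simp]: "i \<in> Basis \<Longrightarrow> coordwise g x \<bullet> i = g (x \<bullet> i)"
  by (simp add: coordwise_def)

text \<open>Substituting \<open>sin (t / L)\<close> for every coordinate turns polynomials into trigonometric sums,
  as a sine is a shifted cosine and products of cosines are sums of cosines.\<close>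

lemma trig_sums_polynomial:
  fixes g :: "'e::euclidean_space \<Rightarrow> real"
  assumes "real_polynomial_function g"
  shows "(\<lambda>x. g (coordwise (\<lambda>t. sin (t / L)) x)) \<in> trig_sums"
  using assms
proof induction
  case (linear f)
  interpret f: bounded_linear f by fact
  have "(\<lambda>x. f (coordwise (\<lambda>t. sin (t / L)) x)) =
     (\<lambda>x. \<Sum>i\<in>Basis. f i * cos (((1 / L) *\<^sub>R i) \<bullet> x + (- pi / 2)))"
  proof
    fix x :: 'e
    have "cos (((1 / L) *\<^sub>R i) \<bullet> x + (- pi / 2)) = sin ((x \<bullet> i) / L)" for i
    proof -
      have "cos (((1 / L) *\<^sub>R i) \<bullet> x + (- pi / 2)) = cos ((x \<bullet> i) / L - pi / 2)"
        by (simp add: inner_commute[of i])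
      also have "\<dots> = sin ((x \<bullet> i) / L)" by (simp add: cos_diff)
      finally show ?thesis .
    qed
    then have "(\<Sum>i\<in>Basis. f i * cos (((1 / L) *\<^sub>R i) \<bullet> x + (- pi / 2))) = (\<Sum>i\<in>Basis. sin ((x \<bullet> i) / L) * f i)"
      by (simp only: mult.commute)
    then show "f (coordwise (\<lambda>t. sin (t / L)) x) = (\<Sum>i\<in>Basis. f i * cos (((1 / L) *\<^sub>R i) \<bullet> x + (- pi / 2)))"
      by (simp only:) (simp add: coordwise_def f.sum f.scaleR)
  qed
  then show ?case by (simp only:) (intro trig_sums_sum finite_Basis trig_sums.wave)
next
  case (const c) then show ?case by (rule trig_sums_const)
next
  case (add f g) show ?case by (rule trig_sums.add[OF add.IH])
next
  case (mult f g) show ?case by (rule trig_sums_mult[OF mult.IH])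
qed

lemma trig_sums_continuous: "g \<in> trig_sums \<Longrightarrow> continuous_on UNIV g"
  by (induction rule: trig_sums.induct) (intro continuous_intros | assumption)+

lemma trig_sums_bounded: "g \<in> trig_sums \<Longrightarrow> \<exists>B. \<forall>x. \<bar>g x\<bar> \<le> B"
proof (induction rule: trig_sums.induct)
  case (wave r u b)
  have "\<bar>r * cos (u \<bullet> x + b)\<bar> \<le> \<bar>r\<bar>" for x
    using mult_left_mono[OF abs_cos_le_one, of "\<bar>r\<bar>"] by (simp add: abs_mult)
  then show ?case by blast
next
  case (add f g)
  then obtain B C where "\<forall>x. \<bar>f x\<bar> \<le> B" "\<forall>x. \<bar>g x\<bar> \<le> C" by blast
  then have "\<bar>f x + g x\<bar> \<le> B + C" for x
    by (meson abs_triangle_ineq add_mono order_trans)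
  then show ?case by blast
qed

text \<open>For \<open>L = 2 R / \<pi>\<close> the substitution \<open>y = sin (x / L)\<close>, with inverse \<open>x = L arcsin y\<close>, identifies the cube of
  half-width \<open>R\<close> with the cube \<open>[-1, 1]\<^sup>d\<close>. A polynomial that approximates \<open>f (L arcsin y)\<close> there
  gives a trigonometric sum close to \<open>f\<close> on the ball of radius \<open>R\<close>; and since \<open>sin\<close> never leaves
  \<open>[-1, 1]\<close>, the bound on the polynomial holds at all points of the space.\<close>

lemma trig_approximation:
  fixes f :: "'e::euclidean_space \<Rightarrow> real"
  assumes f: "continuous_on UNIV f" and B: "\<And>x. \<bar>f x\<bar> \<le> B" and "0 < e" "0 < R"
  obtains g where "g \<in> trig_sums" "\<And>x. norm x \<le> R \<Longrightarrow> \<bar>f x - g x\<bar> < e" "\<And>x. \<bar>g x\<bar> \<le> B + e"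
proof -
  define K :: "'e set" where "K = cbox (- One) One"
  define L where "L = 2 * R / pi"
  have L: "L > 0" using \<open>0 < R\<close> by (simp add: L_def)
  define h where "h y = f (coordwise (\<lambda>t. L * arcsin t) y)" for y :: 'e
  have K: "y \<in> K \<longleftrightarrow> (\<forall>i\<in>Basis. \<bar>y \<bullet> i\<bar> \<le> 1)" for y
    by (auto simp: K_def mem_box abs_le_iff)
  have "continuous_on K (\<lambda>y. coordwise (\<lambda>t. L * arcsin t) y)"
    unfolding coordwise_def
    by (intro continuous_intros continuous_on_arcsin) (auto simp: K abs_le_iff)
  then have h: "continuous_on K h"
    unfolding h_def by (rule continuous_on_compose2[OF f]) simp
  obtain g where g: "real_polynomial_function g" "\<And>y. y \<in> K \<Longrightarrow> \<bar>h y - g y\<bar> < e"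
    using Stone_Weierstrass_real_polynomial_function[OF _ h \<open>0 < e\<close>] by (auto simp: K_def)
  define s :: "'e \<Rightarrow> 'e" where "s = coordwise (\<lambda>t. sin (t / L))"
  have sK: "s x \<in> K" for x by (simp add: s_def K)
  show thesis
  proof
    show "(\<lambda>x. g (s x)) \<in> trig_sums"
      unfolding s_def using g(1) by (rule trig_sums_polynomial)
    show "\<bar>f x - g (s x)\<bar> < e" if "norm x \<le> R" for x
    proof -
      have "L * arcsin (sin ((x \<bullet> i) / L)) = x \<bullet> i" if "i \<in> Basis" for i
      proof -
        have "\<bar>x \<bullet> i\<bar> \<le> R" using Basis_le_norm[OF that, of x] \<open>norm x \<le> R\<close> by simp
        then have "\<bar>x \<bullet> i\<bar> * pi \<le> R * pi" by (intro mult_right_mono) auto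
        then have "\<bar>(x \<bullet> i) / L\<bar> \<le> pi / 2"
          using \<open>0 < R\<close> by (simp add: L_def field_simps abs_mult)
        then have "arcsin (sin ((x \<bullet> i) / L)) = (x \<bullet> i) / L"
          by (intro arcsin_sin) (simp_all only: abs_le_iff, linarith+)
        then show ?thesis using L by simp
      qed
      then have "coordwise (\<lambda>t. L * arcsin t) (s x) = x"
        by (simp add: s_def euclidean_eq_iff[where 'a='e])
      then have "h (s x) = f x" by (simp add: h_def)
      then show ?thesis using g(2)[OF sK[of x]] by simp
    qed
    show "\<bar>g (s x)\<bar> \<le> B + e" for x
    proof -
      have "\<bar>h (s x)\<bar> \<le> B" by (simp add: h_def B)
      then show ?thesis using g(2)[OF sK[of x]] by linarith
    qed
  qed
qed

definition tight_family :: "'a measure \<Rightarrow> (nat \<Rightarrow> 'a \<Rightarrow> 'e::euclidean_space) \<Rightarrow> bool" where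
  "tight_family M Y \<longleftrightarrow> (\<forall>e>0. \<exists>R>0. \<forall>n. measure M {\<omega> \<in> space M. R < norm (Y n \<omega>)} < e)"

lemma (in prob_space) tight_family_const:
  fixes Z :: "'a \<Rightarrow> 'e::euclidean_space"
  assumes [measurable]: "Z \<in> borel_measurable M"
  shows "tight_family M (\<lambda>_. Z)"
  unfolding tight_family_def
proof (intro allI impI)
  fix e :: real assume "0 < e"
  define A where "A k = {\<omega> \<in> space M. real k < norm (Z \<omega>)}" for k :: nat
  have "(\<lambda>k. prob (A k)) \<longlonglongrightarrow> prob (\<Inter>k. A k)"
    by (rule finite_Lim_measure_decseq) (auto simp: A_def decseq_def)
  moreover have "(\<Inter>k. A k) = {}"
  proof -
    have "\<exists>k. \<not> real k < norm (Z \<omega>)" for \<omega>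
      using reals_Archimedean2[of "norm (Z \<omega>)"] by (meson less_asym)
    then show ?thesis by (simp add: A_def set_eq_iff)
  qed
  ultimately have "(\<lambda>k. prob (A k)) \<longlonglongrightarrow> 0" by simp
  then have "\<forall>\<^sub>F k in sequentially. prob (A k) < e \<and> 0 < k"
    using \<open>0 < e\<close> by (intro eventually_conj order_tendstoD eventually_gt_at_top)
  then obtain k where "prob (A k) < e" "0 < k" by (auto simp: eventually_sequentially)
  then show "\<exists>R>0. \<forall>n::nat. prob {\<omega> \<in> space M. R < norm (Z \<omega>)} < e"
    by (intro exI[of _ "real k"]) (simp add: A_def)
qed

lemma (in prob_space) tight_family_second_moment:
  fixes Y :: "nat \<Rightarrow> 'a \<Rightarrow> 'e::euclidean_space"
  assumes [measurable]: "\<And>n. Y n \<in> borel_measurable M"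
    and "\<And>n. integrable M (\<lambda>\<omega>. (norm (Y n \<omega>))\<^sup>2)" "\<And>n. expectation (\<lambda>\<omega>. (norm (Y n \<omega>))\<^sup>2) \<le> C"
  shows "tight_family M Y"
  unfolding tight_family_def
proof (intro allI impI)
  fix e :: real assume "0 < e"
  have C: "0 \<le> C" 
    by (rule order_trans[OF _ assms(3)[of 0]]) (simp add: integral_nonneg_AE)
  define R where "R = sqrt ((C + 1) / e)"
  have R: "R > 0" "R\<^sup>2 = (C + 1) / e" using C \<open>0 < e\<close> by (auto simp: R_def)
  show "\<exists>R>0. \<forall>n. prob {\<omega> \<in> space M. R < norm (Y n \<omega>)} < e"
  proof (intro exI conjI allI)
    fix n
    have "prob {\<omega> \<in> space M. R < norm (Y n \<omega>)} \<le> prob {\<omega> \<in> space M. (norm (Y n \<omega>))\<^sup>2 \<ge> R\<^sup>2}"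
      using R(1) by (intro finite_measure_mono) (auto intro!: power_mono)
    also have "\<dots> \<le> expectation (\<lambda>\<omega>. (norm (Y n \<omega>))\<^sup>2) / R\<^sup>2"
      using R(1) by (intro integral_Markov_inequality_measure[where A="{}"] assms) auto
    also have "\<dots> \<le> C / R\<^sup>2" using R(1) by (intro divide_right_mono assms) auto
    also have "\<dots> < e" using C \<open>0 < e\<close> by (simp add: R(2) field_simps)
    finally show "prob {\<omega> \<in> space M. R < norm (Y n \<omega>)} < e" .
  qed (fact R(1))
qed

text \<open>Two bounded functions that are close off a rare event have close expectations: the form in which tightness is used
  below.\<close>

lemma (in prob_space) expectation_diff_truncate:
  fixes f g :: "'a \<Rightarrow> real"
  assumes [measurable]: "f \<in> borel_measurable M" "g \<in> borel_measurable M" "A \<in> sets M"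
    and b: "\<And>\<omega>. \<omega> \<in> space M \<Longrightarrow> \<bar>f \<omega>\<bar> \<le> B" "\<And>\<omega>. \<omega> \<in> space M \<Longrightarrow> \<bar>g \<omega>\<bar> \<le> C"
    and c: "\<And>\<omega>. \<omega> \<in> space M \<Longrightarrow> \<omega> \<notin> A \<Longrightarrow> \<bar>f \<omega> - g \<omega>\<bar> \<le> e" and "0 \<le> e"
  shows "\<bar>expectation f - expectation g\<bar> \<le> e + (B + C) * prob A"
proof -
  have int: "integrable M f" "integrable M g"
    by (rule integrable_const_bound[where B=B], use b in auto,
        rule integrable_const_bound[where B=C], use b in auto)
  have "\<bar>expectation f - expectation g\<bar> = \<bar>expectation (\<lambda>\<omega>. f \<omega> - g \<omega>)\<bar>"
    using int by simp
  also have "\<dots> \<le> expectation (\<lambda>\<omega>. \<bar>f \<omega> - g \<omega>\<bar>)" by (rule integral_abs_bound)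
  also have "\<dots> \<le> expectation (\<lambda>\<omega>. e + (B + C) * indicator A \<omega>)"
  proof (rule integral_mono)
    fix \<omega> assume w: "\<omega> \<in> space M"
    show "\<bar>f \<omega> - g \<omega>\<bar> \<le> e + (B + C) * indicator A \<omega>"
    proof (cases "\<omega> \<in> A")
      case True then show ?thesis using b[OF w] \<open>0 \<le> e\<close> by simp
    next
      case False then show ?thesis using c[OF w] by simp
    qed
  qed (use int in \<open>auto intro!: integrable_real_indicator simp: less_top[symmetric]\<close>)
  also have "\<dots> = e + (B + C) * prob A"
    by (subst Bochner_Integration.integral_add) (auto simp: prob_space less_top[symmetric])
  finally show ?thesis .
qed

text \<open>The limits for waves extend to trigonometric sums by linearity, and to bounded continuous \<open>f\<close> by
  approximation: outside a ball that carries almost all of the mass, \<open>f\<close> and its approximation are both merely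
  bounded, which suffices.\<close>

lemma levy_cramer_wold:
  fixes Y :: "nat \<Rightarrow> 'a \<Rightarrow> 'e::euclidean_space" and Z :: "'b \<Rightarrow> 'e" and f :: "'e \<Rightarrow> real"
  assumes M: "prob_space M" and N: "prob_space N"
    and Y [measurable]: "\<And>n. Y n \<in> borel_measurable M" and Z [measurable]: "Z \<in> borel_measurable N"
    and tight: "tight_family M Y"
    and conv: "\<And>u b. (\<lambda>n. \<integral>\<omega>. cos (u \<bullet> Y n \<omega> + b) \<partial>M) \<longlonglongrightarrow> (\<integral>\<omega>. cos (u \<bullet> Z \<omega> + b) \<partial>N)"
    and f: "continuous_on UNIV f" and B: "\<And>x. \<bar>f x\<bar> \<le> B"
  shows "(\<lambda>n. \<integral>\<omega>. f (Y n \<omega>) \<partial>M) \<longlonglongrightarrow> (\<integral>\<omega>. f (Z \<omega>) \<partial>N)"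
proof -
  interpret M: prob_space M by fact
  interpret N: prob_space N by fact
  have B0: "0 \<le> B" using B[of 0] by linarith
  have [measurable]: "f \<in> borel_measurable borel" using f by (rule borel_measurable_continuous_onI)
  have trig: "(\<lambda>n. \<integral>\<omega>. g (Y n \<omega>) \<partial>M) \<longlonglongrightarrow> (\<integral>\<omega>. g (Z \<omega>) \<partial>N)" if "g \<in> trig_sums" for g
    using that
  proof induction
    case (wave r u b)
    show ?case using tendsto_mult_left[OF conv[of u b], of r] by simp
  next
    case (add f g)
    have [measurable]: "f \<in> borel_measurable borel" "g \<in> borel_measurable borel"
      using add.hyps by (auto intro!: borel_measurable_continuous_onI trig_sums_continuous)
    obtain F G where "\<forall>x. \<bar>f x\<bar> \<le> F" "\<forall>x. \<bar>g x\<bar> \<le> G"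
      using trig_sums_bounded add.hyps by metis
    then have "integrable M (\<lambda>\<omega>. f (Y n \<omega>))" "integrable N (\<lambda>\<omega>. f (Z \<omega>))"
       "integrable M (\<lambda>\<omega>. g (Y n \<omega>))" "integrable N (\<lambda>\<omega>. g (Z \<omega>))" for n
      by (auto intro: M.integrable_const_bound[where B=F] N.integrable_const_bound[where B=F]
        M.integrable_const_bound[where B=G] N.integrable_const_bound[where B=G])
    then show ?case using tendsto_add[OF add.IH] by simp
  qed
  show ?thesis
  proof (rule LIMSEQ_I)
    fix r :: real assume "0 < r"
    \<comment> \<open>Chosen so that the error \<open>e / 2 + (B + (B + e / 2)) (e / 2)\<close> of the approximation is at most \<open>r / 4\<close>.\<close>
    define e where "e = min 1 (r / (2 * (2 * B + 4)))"
    have e: "0 < e" "e \<le> 1" "e * (2 * B + 4) \<le> r / 2"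
    proof -
      show "0 < e" "e \<le> 1" using \<open>0 < r\<close> B0 by (auto simp: e_def)
      have "e * (2 * B + 4) \<le> (r / (2 * (2 * B + 4))) * (2 * B + 4)"
        using B0 by (intro mult_right_mono) (auto simp: e_def)
      also have "\<dots> = r / 2" using B0 by (simp add: field_simps)
      finally show "e * (2 * B + 4) \<le> r / 2" .
    qed
    obtain R1 where R1: "R1 > 0" "\<And>n. M.prob {\<omega> \<in> space M. R1 < norm (Y n \<omega>)} < e / 2"
      using tight e(1) unfolding tight_family_def by (meson half_gt_zero)
    obtain R2 where R2: "R2 > 0" "N.prob {\<omega> \<in> space N. R2 < norm (Z \<omega>)} < e / 2"
      using N.tight_family_const[OF Z] e(1) unfolding tight_family_def by (meson half_gt_zero)
    define R where "R = max R1 R2"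
    have R: "R > 0" using R1 by (simp add: R_def)
    have pY: "M.prob {\<omega> \<in> space M. R < norm (Y n \<omega>)} \<le> e / 2" for n
      by (rule order_trans[OF M.finite_measure_mono less_imp_le[OF R1(2)[of n]]]) (auto simp: R_def)
    have pZ: "N.prob {\<omega> \<in> space N. R < norm (Z \<omega>)} \<le> e / 2"
      by (rule order_trans[OF N.finite_measure_mono less_imp_le[OF R2(2)]]) (auto simp: R_def)
    obtain g where g: "g \<in> trig_sums" "\<And>x. norm x \<le> R \<Longrightarrow> \<bar>f x - g x\<bar> < e / 2" "\<And>x. \<bar>g x\<bar> \<le> B + e / 2"
      using trig_approximation[OF f B _ R, of "e / 2"] e(1) by (metis half_gt_zero)
    have [measurable]: "g \<in> borel_measurable borel"
      using g(1) by (auto intro!: borel_measurable_continuous_onI trig_sums_continuous)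
    have small: "e / 2 + (B + (B + e / 2)) * p \<le> r / 4" if "p \<le> e / 2" for p
    proof -
      have "(B + (B + e / 2)) * p \<le> (B + (B + e / 2)) * (e / 2)"
        using that B0 e by (intro mult_left_mono) auto
      also have "\<dots> \<le> (2 * B + 1) * (e / 2)" using e by (intro mult_right_mono) auto
      finally show ?thesis using e by (simp add: algebra_simps)
    qed
    have 1: "\<bar>(\<integral>\<omega>. f (Y n \<omega>) \<partial>M) - (\<integral>\<omega>. g (Y n \<omega>) \<partial>M)\<bar> \<le> r / 4" for n
      by (rule order_trans[OF M.expectation_diff_truncate small[OF pY[of n]]])
         (use B g e in \<open>auto intro: less_imp_le simp: not_less\<close>)
    have 2: "\<bar>(\<integral>\<omega>. f (Z \<omega>) \<partial>N) - (\<integral>\<omega>. g (Z \<omega>) \<partial>N)\<bar> \<le> r / 4"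
      by (rule order_trans[OF N.expectation_diff_truncate small[OF pZ]])
         (use B g e in \<open>auto intro: less_imp_le simp: not_less\<close>)
    obtain n0 where n0: "\<And>n. n \<ge> n0 \<Longrightarrow> \<bar>(\<integral>\<omega>. g (Y n \<omega>) \<partial>M) - (\<integral>\<omega>. g (Z \<omega>) \<partial>N)\<bar> < r / 4"
      using LIMSEQ_D[OF trig[OF g(1)], of "r / 4"] \<open>0 < r\<close> by auto
    show "\<exists>no. \<forall>n\<ge>no. norm ((\<integral>\<omega>. f (Y n \<omega>) \<partial>M) - (\<integral>\<omega>. f (Z \<omega>) \<partial>N)) < r"
    proof (intro exI allI impI)
      fix n assume "n \<ge> n0"
      show "norm ((\<integral>\<omega>. f (Y n \<omega>) \<partial>M) - (\<integral>\<omega>. f (Z \<omega>) \<partial>N)) < r"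
        using 1[of n] 2 n0[OF \<open>n \<ge> n0\<close>] \<open>0 < r\<close> unfolding real_norm_def by linarith
    qed
  qed
qed

text \<open>On a compact set \<open>H\<close> is uniformly continuous, so off an event of small
  probability (\<open>Y\<close> large or \<open>A\<close> away from its limit) replacing \<open>A\<close> by its limit \<open>A0\<close> changes \<open>H\<close> by little.\<close>

lemma slutsky:
  fixes Y :: "nat \<Rightarrow> 'a \<Rightarrow> 'e::euclidean_space" and Z :: "'b \<Rightarrow> 'e"
    and A :: "nat \<Rightarrow> 'a \<Rightarrow> 'd::euclidean_space" and H :: "'d \<Rightarrow> 'e \<Rightarrow> real"
  assumes M: "prob_space M"
    and Y [measurable]: "\<And>n. Y n \<in> borel_measurable M"
    and A [measurable]: "\<And>n. A n \<in> borel_measurable M"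
    and tight: "tight_family M Y"
    and conv: "\<And>(f :: 'e \<Rightarrow> real) B. continuous_on UNIV f \<Longrightarrow> (\<And>x. \<bar>f x\<bar> \<le> B) \<Longrightarrow>
       (\<lambda>n. \<integral>\<omega>. f (Y n \<omega>) \<partial>M) \<longlonglongrightarrow> (\<integral>\<omega>. f (Z \<omega>) \<partial>N)"
    and Alim: "AE \<omega> in M. (\<lambda>n. A n \<omega>) \<longlonglongrightarrow> A0"
    and H: "continuous_on UNIV (\<lambda>(x, y). H x y)" and B: "\<And>x y. \<bar>H x y\<bar> \<le> B"
  shows "(\<lambda>n. \<integral>\<omega>. H (A n \<omega>) (Y n \<omega>) \<partial>M) \<longlonglongrightarrow> (\<integral>\<omega>. H A0 (Z \<omega>) \<partial>N)"
proof -
  interpret M: prob_space M by fact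
  have B0: "0 \<le> B" using B[of 0 0] by linarith
  have "continuous_on UNIV (H A0)"
  proof -
    have "continuous_on UNIV (\<lambda>y. (\<lambda>(x, y). H x y) (A0, y))"
      by (rule continuous_on_compose2[OF H]) (auto intro!: continuous_intros)
    then show ?thesis by simp
  qed
  note HA0 = this
  have Hm [measurable]: "(\<lambda>\<omega>. H (f \<omega>) (g \<omega>)) \<in> borel_measurable M"
    if "f \<in> borel_measurable M" "g \<in> borel_measurable M" for f g
    using borel_measurable_continuous_Pair[OF that H[unfolded case_prod_beta]] by simp
  \<comment> \<open>Only this difference needs an argument: for the constant first argument \<open>A0\<close> the limit is assumed.\<close>
  have "(\<lambda>n. (\<integral>\<omega>. H (A n \<omega>) (Y n \<omega>) \<partial>M) - (\<integral>\<omega>. H A0 (Y n \<omega>) \<partial>M)) \<longlonglongrightarrow> 0"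
  proof (rule LIMSEQ_I)
    fix r :: real assume "0 < r"
    define e where "e = r / (2 * B + 1) / 4"
    have e: "0 < e" "2 * B * e \<le> r / 4"
      using \<open>0 < r\<close> B0 by (auto simp: e_def field_simps)
    obtain R where R: "R > 0" "\<And>n. M.prob {\<omega> \<in> space M. R < norm (Y n \<omega>)} < e"
      using tight e(1) unfolding tight_family_def by meson
    have "uniformly_continuous_on (cball A0 1 \<times> cball 0 R) (\<lambda>(x, y). H x y)"
      by (intro compact_uniformly_continuous continuous_on_subset[OF H] compact_Times) auto
    then obtain d where d: "d > 0" "\<And>p q. p \<in> cball A0 1 \<times> cball 0 R \<Longrightarrow> q \<in> cball A0 1 \<times> cball 0 R \<Longrightarrow>
       dist p q < d \<Longrightarrow> dist ((\<lambda>(x, y). H x y) p) ((\<lambda>(x, y). H x y) q) < r / 4"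
      unfolding uniformly_continuous_on_def using \<open>0 < r\<close> by (metis dist_commute zero_less_divide_iff zero_less_numeral)
    define \<delta> where "\<delta> = min d 1"
    have "0 < \<delta>" using d(1) by (simp add: \<delta>_def)
    have close: "\<bar>H x y - H A0 y\<bar> < r / 4" if "dist x A0 < \<delta>" "norm y \<le> R" for x y
    proof -
      have "dist x A0 < 1" "dist (x, y) (A0, y) < d" using that by (auto simp: \<delta>_def dist_Pair_Pair)
      then show ?thesis using d(2)[of "(x, y)" "(A0, y)"] that
        by (simp add: dist_real_def dist_commute)
    qed
    have "(\<lambda>n. M.prob {\<omega> \<in> space M. \<delta> \<le> dist (A n \<omega>) A0}) \<longlonglongrightarrow> 0"
    proof -
      have "(\<lambda>n. M.expectation (indicator {\<omega> \<in> space M. \<delta> \<le> dist (A n \<omega>) A0} :: _ \<Rightarrow> real)) \<longlonglongrightarrow> M.expectation (\<lambda>_. 0)"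
      proof (rule integral_dominated_convergence[where w="\<lambda>_. 1"])
        show "AE \<omega> in M. (\<lambda>n. indicator {\<omega> \<in> space M. \<delta> \<le> dist (A n \<omega>) A0} \<omega> :: real) \<longlonglongrightarrow> 0"
          using Alim
        proof eventually_elim
          case (elim \<omega>)
          then have "\<forall>\<^sub>F n in sequentially. dist (A n \<omega>) A0 < \<delta>" using \<open>0 < \<delta>\<close> by (rule tendstoD)
          then show ?case
            by (intro tendsto_eventually) (auto elim!: eventually_mono simp: indicator_def)
        qed
      qed (auto simp: indicator_def)
      then show ?thesis by simp
    qed
    then have "\<forall>\<^sub>F n in sequentially. M.prob {\<omega> \<in> space M. \<delta> \<le> dist (A n \<omega>) A0} < e"
      using e(1) by (rule order_tendstoD)
    then obtain n0 where n0: "\<And>n. n \<ge> n0 \<Longrightarrow> M.prob {\<omega> \<in> space M. \<delta> \<le> dist (A n \<omega>) A0} < e"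
      by (auto simp: eventually_sequentially)
    show "\<exists>no. \<forall>n\<ge>no. norm ((\<integral>\<omega>. H (A n \<omega>) (Y n \<omega>) \<partial>M) - (\<integral>\<omega>. H A0 (Y n \<omega>) \<partial>M) - 0) < r"
    proof (intro exI allI impI)
      fix n assume "n \<ge> n0"
      define E where "E = {\<omega> \<in> space M. R < norm (Y n \<omega>)} \<union> {\<omega> \<in> space M. \<delta> \<le> dist (A n \<omega>) A0}"
      have "M.prob E \<le> M.prob {\<omega> \<in> space M. R < norm (Y n \<omega>)} + M.prob {\<omega> \<in> space M. \<delta> \<le> dist (A n \<omega>) A0}"
        unfolding E_def by (rule measure_Un_le) auto
      also have "\<dots> \<le> 2 * e" using R(2)[of n] n0[OF \<open>n \<ge> n0\<close>] by simp
      finally have "(B + B) * M.prob E \<le> (B + B) * (2 * e)" using B0 by (intro mult_left_mono) auto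
      moreover have "\<bar>(\<integral>\<omega>. H (A n \<omega>) (Y n \<omega>) \<partial>M) - (\<integral>\<omega>. H A0 (Y n \<omega>) \<partial>M)\<bar> \<le> r / 4 + (B + B) * M.prob E"
        by (rule M.expectation_diff_truncate) (use B close \<open>0 < r\<close> in \<open>auto simp: E_def not_less not_le less_imp_le\<close>)
      ultimately show "norm ((\<integral>\<omega>. H (A n \<omega>) (Y n \<omega>) \<partial>M) - (\<integral>\<omega>. H A0 (Y n \<omega>) \<partial>M) - 0) < r"
        using e \<open>0 < r\<close> by (simp add: algebra_simps)
    qed
  qed
  from tendsto_add[OF this conv[OF HA0 B]] show ?thesis by simp
qed

section \<open>Finite Markov chains along a trajectory\<close>

lemma (in prob_space) integral_finite_range:
  fixes \<Psi> :: "'c \<Rightarrow> 'b::{banach, second_countable_topology}"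
  assumes f: "f \<in> measurable M (count_space A)" and A: "finite A"
  shows "integrable M (\<lambda>\<omega>. \<Psi> (f \<omega>))"
    and "(\<integral>\<omega>. \<Psi> (f \<omega>) \<partial>M) = (\<Sum>y\<in>A. prob {\<omega> \<in> space M. f \<omega> = y} *\<^sub>R \<Psi> y)"
proof -
  have range: "f \<omega> \<in> A" if "\<omega> \<in> space M" for \<omega> using measurable_space[OF f that] by simp
  have meas: "{\<omega> \<in> space M. f \<omega> = y} \<in> events" if "y \<in> A" for y
  proof -
    have "f -` {y} \<inter> space M \<in> events" using that by (intro measurable_sets[OF f]) auto
    also have "f -` {y} \<inter> space M = {\<omega> \<in> space M. f \<omega> = y}" by auto
    finally show ?thesis .
  qed
  have hb: "has_bochner_integral M (\<lambda>\<omega>. \<Sum>y\<in>A. indicator {\<omega> \<in> space M. f \<omega> = y} \<omega> *\<^sub>R \<Psi> y)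
     (\<Sum>y\<in>A. prob {\<omega> \<in> space M. f \<omega> = y} *\<^sub>R \<Psi> y)"
    by (intro has_bochner_integral_sum has_bochner_integral_scaleR_left has_bochner_integral_real_indicator meas)
       (auto simp: less_top[symmetric])
  have eq: "(\<Sum>y\<in>A. indicator {\<omega> \<in> space M. f \<omega> = y} \<omega> *\<^sub>R \<Psi> y) = \<Psi> (f \<omega>)" if "\<omega> \<in> space M" for \<omega>
  proof -
    have "(\<Sum>y\<in>A. indicator {\<omega> \<in> space M. f \<omega> = y} \<omega> *\<^sub>R \<Psi> y) = (\<Sum>y\<in>A. if f \<omega> = y then \<Psi> y else 0)"
      using that by (intro sum.cong) (auto simp: indicator_def)
    also have "\<dots> = \<Psi> (f \<omega>)" using A range[OF that] by simp
    finally show ?thesis .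
  qed
  have "has_bochner_integral M (\<lambda>\<omega>. \<Psi> (f \<omega>)) (\<Sum>y\<in>A. prob {\<omega> \<in> space M. f \<omega> = y} *\<^sub>R \<Psi> y)"
    using hb by (subst has_bochner_integral_cong[OF refl eq[symmetric] refl]) auto
  then show "integrable M (\<lambda>\<omega>. \<Psi> (f \<omega>))"
    and "(\<integral>\<omega>. \<Psi> (f \<omega>) \<partial>M) = (\<Sum>y\<in>A. prob {\<omega> \<in> space M. f \<omega> = y} *\<^sub>R \<Psi> y)"
    by (auto dest: has_bochner_integral_integral_eq simp: has_bochner_integral_iff)
qed

locale finite_chain =
  fixes M :: "'a measure" and X :: "nat \<Rightarrow> 'a \<Rightarrow> 's::finite" and P :: "real^'s^'s"
  assumes chain: "markov_chain M X P" and stoch: "stochastic P"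
begin

sublocale prob_space M using chain by (simp add: markov_chain_def)

lemma X_measurable [measurable]: "X n \<in> measurable M (count_space UNIV)"
  using chain by (simp add: markov_chain_def)

lemma P_nonneg: "0 \<le> P $ i $ j" and P_sum: "(\<Sum>j\<in>UNIV. P $ i $ j) = 1"
  using stoch by (auto simp: stochastic_def prob_vector_def)

text \<open>The trajectory up to time \<open>n\<close>, made extensional so that it takes finitely many values. Expectations of its
  functions are then finite sums, and their measurability and integrability are automatic.\<close>

definition history :: "nat \<Rightarrow> 'a \<Rightarrow> nat \<Rightarrow> 's" where
  "history n \<omega> = restrict (\<lambda>t. X t \<omega>) {..n}"

abbreviation paths :: "nat \<Rightarrow> (nat \<Rightarrow> 's) set" where
  "paths n \<equiv> {..n} \<rightarrow>\<^sub>E UNIV"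

lemma history_apply [simp]: "t \<le> n \<Longrightarrow> history n \<omega> t = X t \<omega>"
  by (simp add: history_def)

lemma finite_paths: "finite (paths n)"
  by (intro finite_PiE) auto

lemma history_eq_iff: "h \<in> paths n \<Longrightarrow> history n \<omega> = h \<longleftrightarrow> (\<forall>t\<le>n. X t \<omega> = h t)"
  by (auto simp: history_def fun_eq_iff PiE_def extensional_def)

lemma history_next_measurable:
  "(\<lambda>\<omega>. (history n \<omega>, X (Suc n) \<omega>)) \<in> measurable M (count_space (paths n \<times> UNIV))"
proof -
  have "(\<lambda>\<omega>. (history n \<omega>, X (Suc n) \<omega>)) -` {(h, j)} \<inter> space M =
      {\<omega> \<in> space M. (\<forall>t\<le>n. X t \<omega> = h t) \<and> X (Suc n) \<omega> = j}" if "h \<in> paths n" for h j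
    using history_eq_iff[OF that] by auto
  moreover have "{\<omega> \<in> space M. (\<forall>t\<le>n. X t \<omega> = h t) \<and> X (Suc n) \<omega> = j} \<in> events" for h j
    by measurable
  ultimately show ?thesis
    using finite_paths by (auto simp: measurable_count_space_eq2 history_def)
qed

lemma history_measurable: "history n \<in> measurable M (count_space (paths n))"
proof -
  have "fst \<in> measurable (count_space (paths n \<times> (UNIV :: 's set))) (count_space (paths n))" by auto
  from measurable_compose[OF history_next_measurable this] show ?thesis by simp
qed

text \<open>The Markov property conditions on a whole trajectory up to time \<open>n\<close>; in product
  form it also covers trajectories of probability zero.\<close>

lemma step_prob:
  "prob {\<omega> \<in> space M. (\<forall>t\<le>n. X t \<omega> = h t) \<and> X (Suc n) \<omega> = j} =
    prob {\<omega> \<in> space M. \<forall>t\<le>n. X t \<omega> = h t} * P $ h n $ j"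
proof -
  define x where "x = h(Suc n := j)"
  have eq: "(\<forall>t\<le>n. X t \<omega> = x t) \<longleftrightarrow> (\<forall>t\<le>n. X t \<omega> = h t)" for \<omega> by (auto simp: x_def)
  define A where "A = {\<omega> \<in> space M. \<forall>t\<le>n. X t \<omega> = h t}"
  have [measurable]: "A \<in> events" unfolding A_def by measurable
  show ?thesis
  proof (cases "prob A > 0")
    case True
    then have "\<P>(\<omega> in M. X (Suc n) \<omega> = x (Suc n) \<bar> \<forall>t\<le>n. X t \<omega> = x t) = P $ x n $ x (Suc n)"
      using chain unfolding markov_chain_def A_def eq[symmetric] by blast
    then have "prob {\<omega> \<in> space M. X (Suc n) \<omega> = j \<and> (\<forall>t\<le>n. X t \<omega> = h t)} / prob A = P $ h n $ j"
      unfolding cond_prob_def eq by (simp add: x_def A_def)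
    then show ?thesis using True by (simp add: A_def field_simps conj_commute)
  next
    case False
    then have "prob A = 0" using measure_nonneg[of M A] by linarith
    moreover have "prob {\<omega> \<in> space M. (\<forall>t\<le>n. X t \<omega> = h t) \<and> X (Suc n) \<omega> = j} \<le> prob A"
      by (rule finite_measure_mono) (auto simp: A_def)
    ultimately show ?thesis by (simp add: A_def measure_le_0_iff)
  qed
qed

text \<open>Conditioning on the trajectory up to time \<open>n\<close>: the next state may be averaged out under the
  current row of \<open>P\<close>.\<close>

lemma expectation_step:
  fixes \<Phi> :: "(nat \<Rightarrow> 's) \<Rightarrow> 's \<Rightarrow> 'b::{banach, second_countable_topology}"
  shows "(\<integral>\<omega>. \<Phi> (history n \<omega>) (X (Suc n) \<omega>) \<partial>M) =
    (\<integral>\<omega>. (\<Sum>j\<in>UNIV. P $ X n \<omega> $ j *\<^sub>R \<Phi> (history n \<omega>) j) \<partial>M)"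
proof -
  have "(\<integral>\<omega>. \<Phi> (history n \<omega>) (X (Suc n) \<omega>) \<partial>M) =
    (\<Sum>(h, j)\<in>paths n \<times> UNIV. prob {\<omega> \<in> space M. history n \<omega> = h \<and> X (Suc n) \<omega> = j} *\<^sub>R \<Phi> h j)"
    using integral_finite_range(2)[OF history_next_measurable, of n "\<lambda>(h, j). \<Phi> h j"] finite_paths
    by (simp add: case_prod_beta prod_eq_iff)
  also have "\<dots> = (\<Sum>h\<in>paths n. \<Sum>j\<in>UNIV. prob {\<omega> \<in> space M. history n \<omega> = h \<and> X (Suc n) \<omega> = j} *\<^sub>R \<Phi> h j)"
    by (rule sum.cartesian_product[symmetric])
  also have "\<dots> = (\<Sum>h\<in>paths n. prob {\<omega> \<in> space M. history n \<omega> = h} *\<^sub>R (\<Sum>j\<in>UNIV. P $ h n $ j *\<^sub>R \<Phi> h j))"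
    by (intro sum.cong refl) (simp add: history_eq_iff step_prob scaleR_sum_right)
  also have "\<dots> = (\<integral>\<omega>. (\<Sum>j\<in>UNIV. P $ history n \<omega> n $ j *\<^sub>R \<Phi> (history n \<omega>) j) \<partial>M)"
    by (rule integral_finite_range(2)[OF history_measurable finite_paths, symmetric])
  finally show ?thesis by simp
qed

lemma integrable_history:
  fixes F :: "(nat \<Rightarrow> 's) \<Rightarrow> 'b::{banach, second_countable_topology}"
  shows "integrable M (\<lambda>\<omega>. F (history n \<omega>))"
  by (rule integral_finite_range(1)[OF history_measurable finite_paths])

section \<open>A strong law for martingale differences\<close>

text \<open>Functions of a transition whose mean given the present state is zero, so that their sums
  along the chain are martingales.\<close>

definition centred :: "('s \<Rightarrow> 's \<Rightarrow> real) \<Rightarrow> bool" where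
  "centred d \<longleftrightarrow> (\<forall>i. (\<Sum>j\<in>UNIV. P $ i $ j * d i j) = 0)"

text \<open>Orthogonality of a martingale difference to the past, stated for vector-valued \<open>F\<close> because it is used
  with real and with complex factors.\<close>

lemma expectation_centred:
  fixes F :: "(nat \<Rightarrow> 's) \<Rightarrow> 'b::{banach, second_countable_topology}"
  assumes "centred d"
  shows "(\<integral>\<omega>. d (X n \<omega>) (X (Suc n) \<omega>) *\<^sub>R F (history n \<omega>) \<partial>M) = 0"
proof -
  have "(\<integral>\<omega>. d (X n \<omega>) (X (Suc n) \<omega>) *\<^sub>R F (history n \<omega>) \<partial>M) =
    (\<integral>\<omega>. (\<Sum>j\<in>UNIV. P $ X n \<omega> $ j *\<^sub>R d (history n \<omega> n) j *\<^sub>R F (history n \<omega>)) \<partial>M)"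
    using expectation_step[of "\<lambda>h j. d (h n) j *\<^sub>R F h" n] by simp
  also have "\<dots> = (\<integral>\<omega>. (\<Sum>j\<in>UNIV. P $ X n \<omega> $ j * d (X n \<omega>) j) *\<^sub>R F (history n \<omega>) \<partial>M)"
    by (simp add: scaleR_sum_left)
  also have "\<dots> = 0" using assms by (simp add: centred_def)
  finally show ?thesis .
qed

definition transition_sum :: "('s \<Rightarrow> 's \<Rightarrow> real) \<Rightarrow> nat \<Rightarrow> 'a \<Rightarrow> real" where
  "transition_sum d n \<omega> = (\<Sum>t<n. d (X t \<omega>) (X (Suc t) \<omega>))"

lemma transition_sum_history: "transition_sum d n \<omega> = (\<Sum>t<n. d (history n \<omega> t) (history n \<omega> (Suc t)))"
  by (simp add: transition_sum_def)

lemma transition_sum_Suc: "transition_sum d (Suc n) \<omega> = transition_sum d n \<omega> + d (X n \<omega>) (X (Suc n) \<omega>)"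
  by (simp add: transition_sum_def)

text \<open>Martingale differences are orthogonal, so only the \<open>n\<close> squares contribute.\<close>

lemma transition_sum_second_moment:
  assumes d: "centred d" and B: "\<And>i j. \<bar>d i j\<bar> \<le> B"
  shows "expectation (\<lambda>\<omega>. (transition_sum d n \<omega>)\<^sup>2) \<le> B\<^sup>2 * real n"
proof (induction n)
  case 0
  then show ?case by (simp add: transition_sum_def)
next
  case (Suc n)
  let ?d = "\<lambda>\<omega>. d (X n \<omega>) (X (Suc n) \<omega>)"
  have int1: "integrable M (\<lambda>\<omega>. (transition_sum d n \<omega>)\<^sup>2)"
    using integrable_history[of "\<lambda>h. (\<Sum>t<n. d (h t) (h (Suc t)))\<^sup>2" n] by (simp add: transition_sum_def)
  have int2: "integrable M (\<lambda>\<omega>. ?d \<omega> * transition_sum d n \<omega>)"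
    using integrable_history[of "\<lambda>h. d (h n) (h (Suc n)) * (\<Sum>t<n. d (h t) (h (Suc t)))" "Suc n"]
    by (simp add: transition_sum_def)
  have int3: "integrable M (\<lambda>\<omega>. (?d \<omega>)\<^sup>2)"
    using integrable_history[of "\<lambda>h. (d (h n) (h (Suc n)))\<^sup>2" "Suc n"] by simp
  have "expectation (\<lambda>\<omega>. ?d \<omega> * transition_sum d n \<omega>) = 0"
    using expectation_centred[OF d, of n "\<lambda>h. (\<Sum>t<n. d (h t) (h (Suc t)))"] by (simp add: transition_sum_history)
  moreover have "expectation (\<lambda>\<omega>. (?d \<omega>)\<^sup>2) \<le> B\<^sup>2"
  proof -
    have "expectation (\<lambda>\<omega>. (?d \<omega>)\<^sup>2) \<le> expectation (\<lambda>\<omega>. B\<^sup>2)"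
      by (rule integral_mono[OF int3]) (auto intro!: abs_le_square_iff[THEN iffD1] order_trans[OF B abs_ge_self])
    then show ?thesis by (simp add: prob_space)
  qed
  moreover have "expectation (\<lambda>\<omega>. (transition_sum d (Suc n) \<omega>)\<^sup>2) =
     expectation (\<lambda>\<omega>. (transition_sum d n \<omega>)\<^sup>2 + 2 * (?d \<omega> * transition_sum d n \<omega>) + (?d \<omega>)\<^sup>2)"
    by (intro Bochner_Integration.integral_cong) (simp_all add: transition_sum_Suc power2_eq_square algebra_simps)
  ultimately show ?case using Suc.IH int1 int2 int3 by (simp add: algebra_simps)
qed

end

text \<open>The distance from \<open>n\<close> down to the largest square \<open>q\<^sup>2\<close> below it is at most \<open>2 q\<close>, so bounded steps change the sequence by
  \<open>O(q)\<close>, which is negligible against \<open>q\<^sup>2\<close>.\<close>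

lemma sublinear_from_squares:
  fixes s :: "nat \<Rightarrow> real"
  assumes step: "\<And>n. \<bar>s (Suc n) - s n\<bar> \<le> B"
    and sq: "(\<lambda>k. s (k\<^sup>2) / real (k\<^sup>2)) \<longlonglongrightarrow> 0"
  shows "(\<lambda>n. s n / real n) \<longlonglongrightarrow> 0"
proof -
  have B0: "0 \<le> B" using step[of 0] by linarith
  have step': "\<bar>s (n + r) - s n\<bar> \<le> B * real r" for n r
  proof (induction r)
    case (Suc r)
    then show ?case using step[of "n + r"] by (simp add: algebra_simps)
  qed simp
  define k where "k n = nat \<lfloor>sqrt (real n)\<rfloor>" for n
  have k_top: "filterlim k at_top sequentially"
    unfolding k_def
    by (intro filterlim_compose[OF filterlim_nat_sequentially] filterlim_compose[OF filterlim_floor_sequentially]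
        filterlim_compose[OF sqrt_at_top] filterlim_real_sequentially)
  have lo: "(k n)\<^sup>2 \<le> n" for n
  proof -
    have "real (k n) \<le> sqrt (real n)" by (simp add: k_def)
    then have "(real (k n))\<^sup>2 \<le> (sqrt (real n))\<^sup>2" by (intro power_mono) auto
    then have "real ((k n)\<^sup>2) \<le> real n" by simp
    then show ?thesis by (simp only: of_nat_le_iff)
  qed
  have hi: "n \<le> (k n)\<^sup>2 + 2 * k n" for n
  proof -
    have "sqrt (real n) < real (k n) + 1" by (simp add: k_def)
    then have "(sqrt (real n))\<^sup>2 < (real (k n) + 1)\<^sup>2" by (intro power_strict_mono) auto
    then have "real n < real ((k n)\<^sup>2 + 2 * k n + 1)" by (simp add: power2_eq_square algebra_simps)
    then show ?thesis by (simp only: of_nat_less_iff)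
  qed
  have "(\<lambda>n. \<bar>s ((k n)\<^sup>2) / real ((k n)\<^sup>2)\<bar> + 2 * B * inverse (real (k n))) \<longlonglongrightarrow> \<bar>0\<bar> + 2 * B * 0"
    by (intro tendsto_intros filterlim_compose[OF sq k_top]
         filterlim_compose[OF tendsto_inverse_0_at_top[OF filterlim_real_sequentially] k_top]) 
  then have lim: "(\<lambda>n. \<bar>s ((k n)\<^sup>2) / real ((k n)\<^sup>2)\<bar> + 2 * B * inverse (real (k n))) \<longlonglongrightarrow> 0" by simp
  show ?thesis
  proof (rule Lim_null_comparison[OF _ lim])
    show "\<forall>\<^sub>F n in sequentially. norm (s n / real n) \<le> \<bar>s ((k n)\<^sup>2) / real ((k n)\<^sup>2)\<bar> + 2 * B * inverse (real (k n))"
    proof -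
      have "\<forall>\<^sub>F n in sequentially. 0 < k n"
        using k_top by (metis eventually_gt_at_top filterlim_iff)
      then show ?thesis
      proof eventually_elim
        case (elim n)
        define q where "q = k n"
        have q: "0 < q" "q\<^sup>2 \<le> n" "n \<le> q\<^sup>2 + 2 * q" using elim lo hi by (auto simp: q_def)
        have q2: "0 < real (q\<^sup>2)" "real (q\<^sup>2) \<le> real n" using q by (simp_all only: of_nat_0_less_iff of_nat_le_iff) simp
        have "\<bar>s (q\<^sup>2 + (n - q\<^sup>2)) - s (q\<^sup>2)\<bar> \<le> B * real (n - q\<^sup>2)" by (rule step')
        also have "\<dots> \<le> B * (2 * real q)"
        proof (intro mult_left_mono B0)
          have "n - q\<^sup>2 \<le> 2 * q" using q(3) by arith
          from of_nat_mono[OF this, where 'a=real] show "real (n - q\<^sup>2) \<le> 2 * real q" by simp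
        qed
        finally have "\<bar>s n\<bar> \<le> \<bar>s (q\<^sup>2)\<bar> + 2 * B * real q" using q by simp
        then have step1: "\<bar>s n\<bar> / real n \<le> (\<bar>s (q\<^sup>2)\<bar> + 2 * B * real q) / real n" by (intro divide_right_mono) auto
        have npos: "0 < n" using q zero_less_power[OF q(1), of 2] by linarith
        have step2: "(\<bar>s (q\<^sup>2)\<bar> + 2 * B * real q) / real n \<le> (\<bar>s (q\<^sup>2)\<bar> + 2 * B * real q) / real (q\<^sup>2)"
          using q2 B0 npos q(1) by (intro divide_left_mono mult_pos_pos) simp_all
        note order_trans[OF step1 step2]
        also have "(\<bar>s (q\<^sup>2)\<bar> + 2 * B * real q) / real (q\<^sup>2) = \<bar>s (q\<^sup>2) / real (q\<^sup>2)\<bar> + 2 * B * inverse (real q)"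
          using q by (simp add: field_simps power2_eq_square)
        finally show ?case by (simp add: q_def)
      qed
    qed
  qed
qed

context finite_chain begin

lemma bounded_increments:
  fixes d :: "'s \<Rightarrow> 's \<Rightarrow> real"
  obtains B where "\<And>i j. \<bar>d i j\<bar> \<le> B"
proof -
  have "\<bar>d i j\<bar> \<le> (\<Sum>i\<in>UNIV. \<Sum>j\<in>UNIV. \<bar>d i j\<bar>)" for i j
  proof -
    have "\<bar>d i j\<bar> \<le> (\<Sum>j\<in>UNIV. \<bar>d i j\<bar>)" by (rule member_le_sum) auto
    also have "\<dots> \<le> (\<Sum>i\<in>UNIV. \<Sum>j\<in>UNIV. \<bar>d i j\<bar>)"
      by (rule member_le_sum[where f="\<lambda>i. \<Sum>j\<in>UNIV. \<bar>d i j\<bar>"]) (auto intro: sum_nonneg)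
    finally show ?thesis .
  qed
  then show thesis by (rule that)
qed

text \<open>Along \<open>n = k\<^sup>2\<close> the squared averages have expectations of order \<open>1 / k\<^sup>2\<close>. Their sum over \<open>k\<close>
  therefore has finite expectation, is finite almost surely, and its terms tend to zero.\<close>

lemma transition_sum_strong_law:
  assumes d: "centred d"
  shows "AE \<omega> in M. (\<lambda>n. transition_sum d n \<omega> / real n) \<longlonglongrightarrow> 0"
proof -
  obtain B where B: "\<And>i j. \<bar>d i j\<bar> \<le> B" using bounded_increments[of d] by blast
  define T where "T k \<omega> = (transition_sum d ((Suc k)\<^sup>2) \<omega> / real ((Suc k)\<^sup>2))\<^sup>2" for k \<omega>
  have intT: "integrable M (T k)" for k
    using integrable_history[of "\<lambda>h. ((\<Sum>t<(Suc k)\<^sup>2. d (h t) (h (Suc t))) / real ((Suc k)\<^sup>2))\<^sup>2" "(Suc k)\<^sup>2"]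
    unfolding T_def by (simp only: transition_sum_history)
  have [measurable]: "T k \<in> borel_measurable M" for k using intT by auto
  have T0: "0 \<le> T k \<omega>" for k \<omega> by (simp add: T_def)
  have ET: "expectation (T k) \<le> B\<^sup>2 * inverse (real (Suc k) ^ 2)" for k
  proof -
    have "expectation (T k) = expectation (\<lambda>\<omega>. (transition_sum d ((Suc k)\<^sup>2) \<omega>)\<^sup>2) / (real ((Suc k)\<^sup>2))\<^sup>2"
      unfolding T_def power_divide by simp
    also have "\<dots> \<le> (B\<^sup>2 * real ((Suc k)\<^sup>2)) / (real ((Suc k)\<^sup>2))\<^sup>2"
      by (intro divide_right_mono transition_sum_second_moment d B) auto
    also have "\<dots> = B\<^sup>2 * inverse (real (Suc k) ^ 2)" 
      by (simp add: power2_eq_square field_simps del: of_nat_Suc mult_Suc mult_Suc_right)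
    finally show ?thesis .
  qed
  have summ: "summable (\<lambda>k. B\<^sup>2 * inverse (real (Suc k) ^ 2))"
  proof (rule summable_mult)
    have "summable (\<lambda>k. inverse (real k ^ 2))" using inverse_power_summable[of 2, where 'a=real] by simp
    then show "summable (\<lambda>k. inverse (real (Suc k) ^ 2))"
      by (subst summable_Suc_iff)
  qed
  have "(\<integral>\<^sup>+\<omega>. (\<Sum>k. ennreal (T k \<omega>)) \<partial>M) = (\<Sum>k. \<integral>\<^sup>+\<omega>. ennreal (T k \<omega>) \<partial>M)"
    by (rule nn_integral_suminf) measurable
  also have "\<dots> = (\<Sum>k. ennreal (expectation (T k)))"
    by (intro suminf_cong nn_integral_eq_integral intT) (simp add: T0)
  also have "\<dots> \<le> (\<Sum>k. ennreal (B\<^sup>2 * inverse (real (Suc k) ^ 2)))"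
    by (intro suminf_le ennreal_leI ET) auto
  also have "\<dots> = ennreal (\<Sum>k. B\<^sup>2 * inverse (real (Suc k) ^ 2))"
    by (rule suminf_ennreal2[OF _ summ]) simp
  finally have "(\<integral>\<^sup>+\<omega>. (\<Sum>k. ennreal (T k \<omega>)) \<partial>M) \<noteq> \<infinity>" by (auto simp: top_unique)
  then have "AE \<omega> in M. (\<Sum>k. ennreal (T k \<omega>)) \<noteq> \<infinity>" by (intro nn_integral_PInf_AE) measurable
  then show ?thesis
  proof eventually_elim
    case (elim \<omega>)
    then have "summable (\<lambda>k. T k \<omega>)" by (intro summable_suminf_not_top T0) simp
    then have "(\<lambda>k. T k \<omega>) \<longlonglongrightarrow> 0" by (rule summable_LIMSEQ_zero)
    then have "(\<lambda>k. transition_sum d ((Suc k)\<^sup>2) \<omega> / real ((Suc k)\<^sup>2)) \<longlonglongrightarrow> 0"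
      unfolding T_def by (simp only: power_tendsto_0_iff[of 2] zero_less_numeral)
    then have "(\<lambda>k. transition_sum d (k\<^sup>2) \<omega> / real (k\<^sup>2)) \<longlonglongrightarrow> 0"
      by (rule LIMSEQ_imp_Suc)
    then show ?case
      by (rule sublinear_from_squares[rotated, where B=B]) (simp add: transition_sum_Suc B)
  qed
qed

end

section \<open>The stationary vector and the ergodic theorem\<close>

lemma stationary_iterate:
  assumes "v v* P = v" shows "v v* matpow P n = v"
  by (induction n) (simp_all add: assms vector_matrix_mul_assoc[symmetric])

lemma matpow_nonneg:
  assumes "stochastic P" shows "0 \<le> matpow P n $ i $ j"
proof (induction n arbitrary: j)
  case (Suc n)
  then show ?case using assms
    by (auto simp: matrix_matrix_mult_def stochastic_def prob_vector_def intro!: sum_nonneg)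
qed (simp add: mat_def)

text \<open>Iterating the fixed point equation transports mass from \<open>i\<close> to \<open>j\<close> along a path of positive
  probability.\<close>

lemma fixed_vector_pos:
  assumes P: "stochastic P" "irreducible_mat P"
    and v: "\<And>i. 0 \<le> v $ i" "v v* P = v" "0 < v $ i"
  shows "0 < v $ j"
proof -
  obtain n where n: "0 < matpow P n $ i $ j" using P(2) by (auto simp: irreducible_mat_def)
  have "0 < v $ i * matpow P n $ i $ j" using v n by simp
  also have "\<dots> \<le> (\<Sum>i\<in>UNIV. v $ i * matpow P n $ i $ j)"
    by (rule member_le_sum) (simp_all add: v matpow_nonneg[OF P(1)])
  also have "\<dots> = (v v* matpow P n) $ j" by (simp add: vector_matrix_mult_def)
  finally show ?thesis by (simp add: stationary_iterate[OF v(2)])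
qed

text \<open>If \<open>v\<close> is fixed then so is \<open>\<bar>v\<bar>\<close>: the triangle inequality gives \<open>\<bar>v\<bar> \<le> \<bar>v\<bar> P\<close>
  entrywise, and both sides have the same total. So \<open>\<bar>v\<bar> + v\<close> and \<open>\<bar>v\<bar> - v\<close> are nonnegative
  fixed vectors, each of them either zero or positive everywhere; in the second case \<open>v\<close> would have a constant
  strict sign, against its total of zero.\<close>

lemma fixed_vector_sum_zero:
  fixes P :: "real^'s^'s"
  assumes P: "stochastic P" "irreducible_mat P"
    and v: "v v* P = v" "(\<Sum>i\<in>UNIV. v $ i) = 0"
  shows "v = 0"
proof -
  have P0: "0 \<le> P $ i $ j" and P1: "(\<Sum>j\<in>UNIV. P $ i $ j) = 1" for i j
    using P(1) by (auto simp: stochastic_def prob_vector_def)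
  define w :: "real^'s" where "w = (\<chi> i. \<bar>v $ i\<bar>)"
  have le: "w $ j \<le> (w v* P) $ j" for j
  proof -
    have "\<bar>v $ j\<bar> = \<bar>\<Sum>i\<in>UNIV. v $ i * P $ i $ j\<bar>"
      by (subst v(1)[symmetric]) (simp add: vector_matrix_mult_def)
    also have "\<dots> \<le> (\<Sum>i\<in>UNIV. \<bar>v $ i * P $ i $ j\<bar>)" by (rule sum_abs)
    finally show ?thesis by (simp add: w_def vector_matrix_mult_def abs_mult P0)
  qed
  have "(\<Sum>j\<in>UNIV. (w v* P) $ j) = (\<Sum>i\<in>UNIV. \<Sum>j\<in>UNIV. w $ i * P $ i $ j)"
    by (simp add: vector_matrix_mult_def) (rule sum.swap)
  also have "\<dots> = (\<Sum>i\<in>UNIV. w $ i)" by (simp add: sum_distrib_left[symmetric] P1)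
  finally have "(\<Sum>j\<in>UNIV. (w v* P) $ j - w $ j) = 0" by (simp add: sum_subtractf)
  then have "\<forall>j\<in>UNIV. (w v* P) $ j - w $ j = 0"
    by (subst (asm) sum_nonneg_eq_0_iff) (auto simp: le)
  then have w: "w v* P = w" by (simp add: vec_eq_iff)
  have half: "u = 0" if u: "u = w + r *\<^sub>R v" and r: "r = 1 \<or> r = -1" for u r
  proof (rule ccontr)
    have u0: "0 \<le> u $ i" for i using r by (auto simp: u w_def)
    have "(r *\<^sub>R v) v* P = r *\<^sub>R v"
      using r v(1) by (auto simp: vec_eq_iff vector_matrix_mult_def sum_negf)
    then have uP: "u v* P = u" by (simp add: u vector_matrix_left_distrib w)
    assume "u \<noteq> 0"
    then obtain i where "u $ i \<noteq> 0" by (auto simp: vec_eq_iff)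
    then have "0 < u $ i" using u0[of i] by simp
    then have "0 < u $ j" for j by (rule fixed_vector_pos[OF P u0 uP])
    then have "0 < \<bar>v $ j\<bar> + r * v $ j" for j by (simp add: u w_def)
    moreover have "0 < r * x" if "0 < \<bar>x\<bar> + r * x" for x
      using r that by (auto simp: abs_if split: if_splits)
    ultimately have "0 < r * v $ j" for j by blast
    then have "0 < (\<Sum>j\<in>UNIV. r * v $ j)" by (intro sum_pos) auto
    then show False using v(2) by (simp add: sum_distrib_left[symmetric])
  qed
  have "w + 1 *\<^sub>R v = 0" "w + (-1) *\<^sub>R v = 0" by (rule half[OF refl]; simp)+
  then have "v $ i = 0" for i by (auto simp: vec_eq_iff)
  then show ?thesis by (simp add: vec_eq_iff)
qed

lemma stationary_pos:
  assumes "stochastic P" "irreducible_mat P" "stationary P \<pi>"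
  shows "0 < \<pi> $ j"
proof -
  have \<pi>: "\<And>i. 0 \<le> \<pi> $ i" "(\<Sum>i\<in>UNIV. \<pi> $ i) = 1" "\<pi> v* P = \<pi>"
    using assms(3) by (auto simp: stationary_def prob_vector_def)
  have "\<exists>i. \<pi> $ i \<noteq> 0" using \<pi>(2) by (metis sum.neutral zero_neq_one)
  then obtain i where "0 < \<pi> $ i" using \<pi>(1) by (metis order_le_less)
  then show ?thesis by (rule fixed_vector_pos[OF assms(1,2) \<pi>(1,3)])
qed

text \<open>An injective linear map between finite-dimensional spaces has a continuous left inverse. Applied to
  \<open>u \<mapsto> (u P - u, \<Sum>\<^sub>i u\<^sub>i)\<close>, it recovers the limit of \<open>v\<close> from the limits \<open>0\<close> and \<open>1\<close>.\<close>

lemma asymptotically_stationary_limit: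
  fixes P :: "real^'s^'s" and v :: "nat \<Rightarrow> real^'s"
  assumes P: "stochastic P" "irreducible_mat P" "stationary P \<pi>"
    and fixed: "(\<lambda>n. v n v* P - v n) \<longlonglongrightarrow> 0" and mass: "(\<lambda>n. \<Sum>i\<in>UNIV. v n $ i) \<longlonglongrightarrow> 1"
  shows "v \<longlonglongrightarrow> \<pi>"
proof -
  define L where "L u = (u v* P - u, \<Sum>i\<in>UNIV. u $ i)" for u :: "real^'s"
  have L: "linear L"
    by (rule linearI)
       (simp_all add: L_def vec_eq_iff vector_matrix_mult_def algebra_simps sum.distrib sum_distrib_left)
  have "inj L"
    unfolding linear_injective_0[OF L]
  proof (intro allI impI)
    fix u assume "L u = 0"
    then have "u v* P = u" "(\<Sum>i\<in>UNIV. u $ i) = 0" by (auto simp: L_def zero_prod_def)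
    then show "u = 0" by (rule fixed_vector_sum_zero[OF P(1,2)])
  qed
  then obtain g where g: "linear g" "g \<circ> L = id" using linear_injective_left_inverse[OF L] by blast
  have \<pi>: "L \<pi> = (0, 1)" using P(3) by (simp add: L_def stationary_def prob_vector_def)
  have "(\<lambda>n. L (v n)) \<longlonglongrightarrow> (0, 1)"
    unfolding L_def by (intro tendsto_Pair fixed mass)
  then have "(\<lambda>n. L (v n)) \<longlonglongrightarrow> L \<pi>" unfolding \<pi> .
  then have "(\<lambda>n. g (L (v n))) \<longlonglongrightarrow> g (L \<pi>)"
    by (rule bounded_linear.tendsto[OF linear_conv_bounded_linear[THEN iffD1, OF g(1)]])
  then show ?thesis using g(2) by (simp add: fun_eq_iff)
qed

context finite_chain begin

lemma transition_sum_diff: "transition_sum (\<lambda>x y. d x y - e x y) n \<omega> = transition_sum d n \<omega> - transition_sum e n \<omega>"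
  and transition_sum_scale: "transition_sum (\<lambda>x y. r * d x y) n \<omega> = r * transition_sum d n \<omega>"
  and transition_sum_sum: "transition_sum (\<lambda>x y. \<Sum>k\<in>A. D k x y) n \<omega> = (\<Sum>k\<in>A. transition_sum (D k) n \<omega>)"
  by (simp_all add: transition_sum_def sum_subtractf sum_distrib_left) (rule sum.swap)

lemma trans_count_psum: "real (trans_count X n \<omega> i j) = transition_sum (\<lambda>x y. of_bool (x = i \<and> y = j)) n \<omega>"
proof -
  have "{t. t < n \<and> X t \<omega> = i \<and> X (Suc t) \<omega> = j} = {..<n} \<inter> {t. X t \<omega> = i \<and> X (Suc t) \<omega> = j}" by auto
  then show ?thesis by (simp add: trans_count_def transition_sum_def)
qed

lemma visit_count_psum: "real (visit_count X n \<omega> i) = transition_sum (\<lambda>x y. of_bool (x = i)) n \<omega>"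
proof -
  have "(\<Sum>j\<in>UNIV. of_bool (x = i \<and> y = j)) = (of_bool (x = i) :: real)" for x y :: 's
  proof -
    have "(\<Sum>j\<in>UNIV. of_bool (x = i \<and> y = j)) = (\<Sum>j\<in>UNIV. if y = j then of_bool (x = i) else (0::real))"
      by (intro sum.cong) auto
    also have "\<dots> = of_bool (x = i)" by simp
    finally show ?thesis .
  qed
  then show ?thesis
    by (simp add: visit_count_def trans_count_psum transition_sum_sum[symmetric] del: sum_of_bool_eq)
qed

lemma visit_count_total: "(\<Sum>i\<in>UNIV. real (visit_count X n \<omega> i)) = real n"
proof -
  have "(\<Sum>i\<in>UNIV. of_bool (x = i)) = (1::real)" for x :: 's by simp
  then show ?thesis
    by (simp add: visit_count_psum transition_sum_sum[symmetric] del: sum_of_bool_eq) (simp add: transition_sum_def)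
qed

text \<open>The martingale difference whose sum is \<open>N\<^sub>i\<^sub>j - p\<^sub>i\<^sub>j N\<^sub>i\<close>.\<close>

definition deviation :: "'s \<Rightarrow> 's \<Rightarrow> 's \<Rightarrow> 's \<Rightarrow> real" where
  "deviation i j x y = of_bool (x = i) * (of_bool (y = j) - P $ i $ j)"

lemma sum_P_of_bool: "(\<Sum>y\<in>UNIV. P $ x $ y * of_bool (y = j)) = P $ x $ j"
proof -
  have "(\<Sum>y\<in>UNIV. P $ x $ y * of_bool (y = j)) = (\<Sum>y\<in>UNIV. if y = j then P $ x $ y else 0)"
    by (intro sum.cong) auto
  then show ?thesis by simp
qed

lemma centred_deviation: "centred (deviation i j)"
proof -
  have "(\<Sum>y\<in>UNIV. P $ x $ y * deviation i j x y) = of_bool (x = i) *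
     ((\<Sum>y\<in>UNIV. P $ x $ y * of_bool (y = j)) - (\<Sum>y\<in>UNIV. P $ x $ y) * P $ i $ j)" for x
    by (simp add: deviation_def sum_distrib_left sum_distrib_right sum_subtractf right_diff_distrib mult_ac
       del: sum_of_bool_eq sum_mult_of_bool_eq)
  then show ?thesis by (auto simp: centred_def sum_P_of_bool P_sum)
qed

lemma transition_sum_deviation:
  "transition_sum (deviation i j) n \<omega> = real (trans_count X n \<omega> i j) - P $ i $ j * real (visit_count X n \<omega> i)"
  unfolding trans_count_psum visit_count_psum transition_sum_scale[symmetric] transition_sum_diff[symmetric]
  by (rule arg_cong[where f="\<lambda>d. transition_sum d n \<omega>"]) (auto simp: deviation_def fun_eq_iff)

lemma P_hat_error:
  assumes "visit_count X n \<omega> i \<noteq> 0"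
  shows "P_hat X n \<omega> $ i $ j - P $ i $ j = transition_sum (deviation i j) n \<omega> / real (visit_count X n \<omega> i)"
  using assms by (simp add: P_hat_def transition_sum_deviation field_simps)

text \<open>Up to the two end points, the number of arrivals in \<open>j\<close> is the number of departures from \<open>j\<close>; the arrivals
  differ from their conditional means, which sum to \<open>(\<Sum>\<^sub>i N\<^sub>i p\<^sub>i\<^sub>j)\<close>, by a martingale.\<close>

lemma arrivals_balance:
  "(\<Sum>i\<in>UNIV. real (visit_count X n \<omega> i) * P $ i $ j) - real (visit_count X n \<omega> j) =
     of_bool (X n \<omega> = j) - of_bool (X 0 \<omega> = j) - transition_sum (\<lambda>x y. of_bool (y = j) - P $ x $ j) n \<omega>"
proof -
  have "(\<Sum>i\<in>UNIV. real (visit_count X n \<omega> i) * P $ i $ j) = transition_sum (\<lambda>x y. \<Sum>i\<in>UNIV. P $ i $ j * of_bool (x = i)) n \<omega>"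
    by (simp only: visit_count_psum transition_sum_sum transition_sum_scale) (simp only: mult.commute)
  also have "(\<lambda>x y. \<Sum>i\<in>UNIV. P $ i $ j * of_bool (x = i)) = (\<lambda>x (y::'s). P $ x $ j)"
  proof (intro ext)
    fix x y :: 's
    have "(\<Sum>i\<in>UNIV. P $ i $ j * of_bool (x = i)) = (\<Sum>i\<in>UNIV. if x = i then P $ i $ j else 0)"
      by (intro sum.cong) auto
    then show "(\<Sum>i\<in>UNIV. P $ i $ j * of_bool (x = i)) = P $ x $ j" by simp
  qed
  finally have 1: "(\<Sum>i\<in>UNIV. real (visit_count X n \<omega> i) * P $ i $ j) = transition_sum (\<lambda>x y. P $ x $ j) n \<omega>" .
  have 2: "transition_sum (\<lambda>x y. of_bool (y = j)) n \<omega> =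
     transition_sum (\<lambda>x y. of_bool (x = j)) n \<omega> + of_bool (X n \<omega> = j) - of_bool (X 0 \<omega> = j)"
    by (induction n) (simp_all add: transition_sum_Suc, simp add: transition_sum_def)
  show ?thesis unfolding 1 unfolding transition_sum_diff 2 visit_count_psum by simp
qed

end

locale ergodic_chain = finite_chain M X P
  for M :: "'a measure" and X :: "nat \<Rightarrow> 'a \<Rightarrow> 's::finite" and P :: "real^'s^'s" +
  fixes \<pi> :: "real^'s"
  assumes irred: "irreducible_mat P" and stat: "stationary P \<pi>"
begin

text \<open>By the balance of arrivals and the strong law, the empirical distribution is asymptotically stationary.\<close>

lemma visit_frequency:
  "AE \<omega> in M. \<forall>i. (\<lambda>n. real (visit_count X n \<omega> i) / real n) \<longlonglongrightarrow> \<pi> $ i"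
proof -
  have "AE \<omega> in M. \<forall>j\<in>UNIV. (\<lambda>n. transition_sum (\<lambda>x y. of_bool (y = j) - P $ x $ j) n \<omega> / real n) \<longlonglongrightarrow> 0"
  proof (intro AE_finite_allI transition_sum_strong_law)
    fix j show "centred (\<lambda>x y. of_bool (y = j) - P $ x $ j)"
      by (simp add: centred_def right_diff_distrib sum_subtractf sum_P_of_bool sum_distrib_right[symmetric] P_sum
        del: sum_mult_of_bool_eq)
  qed simp
  then show ?thesis
  proof eventually_elim
    case (elim \<omega>)
    define v :: "nat \<Rightarrow> real^'s" where "v n = (\<chi> i. real (visit_count X n \<omega> i) / real n)" for n
    have "v \<longlonglongrightarrow> \<pi>"
    proof (rule asymptotically_stationary_limit[OF stoch irred stat])
      show "(\<lambda>n. v n v* P - v n) \<longlonglongrightarrow> 0"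
      proof (rule vec_tendstoI)
        fix j
        have eq: "(v n v* P - v n) $ j = (of_bool (X n \<omega> = j) - of_bool (X 0 \<omega> = j)) / real n
           - transition_sum (\<lambda>x y. of_bool (y = j) - P $ x $ j) n \<omega> / real n" for n
        proof -
          have "(v n v* P - v n) $ j =
            ((\<Sum>i\<in>UNIV. real (visit_count X n \<omega> i) * P $ i $ j) - real (visit_count X n \<omega> j)) / real n"
            by (simp add: v_def vector_matrix_mult_def diff_divide_distrib sum_divide_distrib)
          also note arrivals_balance
          finally show ?thesis by (simp add: diff_divide_distrib)
        qed
        have "(\<lambda>n. (of_bool (X n \<omega> = j) - of_bool (X 0 \<omega> = j)) / real n) \<longlonglongrightarrow> (0::real)"
          by (rule Lim_null_comparison[OF _ lim_1_over_n]) (auto intro!: always_eventually divide_right_mono)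
        from tendsto_diff[OF this bspec[OF elim, of j]]
        show "(\<lambda>n. (v n v* P - v n) $ j) \<longlonglongrightarrow> 0 $ j" unfolding eq by simp
      qed
      have "\<forall>\<^sub>F n in sequentially. (\<Sum>i\<in>UNIV. v n $ i) = 1"
        using eventually_gt_at_top[of 0]
        by eventually_elim (simp add: v_def sum_divide_distrib[symmetric] visit_count_total)
      then show "(\<lambda>n. \<Sum>i\<in>UNIV. v n $ i) \<longlonglongrightarrow> 1" by (rule tendsto_eventually)
    qed
    then have "(\<lambda>n. v n $ i) \<longlonglongrightarrow> \<pi> $ i" for i by (rule tendsto_vec_nth)
    then show ?case by (simp add: v_def)
  qed
qed

lemma \<pi>_pos: "0 < \<pi> $ i" by (rule stationary_pos[OF stoch irred stat])

lemma inverse_visit_frequency: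
  "AE \<omega> in M. (\<lambda>n. \<chi> i. real n / real (visit_count X n \<omega> i)) \<longlonglongrightarrow> (\<chi> i. inverse (\<pi> $ i))"
  using visit_frequency
proof eventually_elim
  case (elim \<omega>)
  show ?case
  proof (rule vec_tendstoI)
    fix i
    have "(\<lambda>n. inverse (real (visit_count X n \<omega> i) / real n)) \<longlonglongrightarrow> inverse (\<pi> $ i)"
      using \<pi>_pos[of i] by (intro tendsto_inverse elim[rule_format]) simp
    then show "(\<lambda>n. (\<chi> i. real n / real (visit_count X n \<omega> i)) $ i) \<longlonglongrightarrow> (\<chi> i. inverse (\<pi> $ i)) $ i"
      by (simp add: inverse_eq_divide)
  qed
qed

lemma eventually_all_visited:
  "AE \<omega> in M. \<forall>\<^sub>F n in sequentially. \<forall>i. visit_count X n \<omega> i \<noteq> 0"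
  using visit_frequency
proof eventually_elim
  case (elim \<omega>)
  have "\<forall>\<^sub>F n in sequentially. visit_count X n \<omega> i \<noteq> 0" for i
  proof -
    have "\<forall>\<^sub>F n in sequentially. 0 < real (visit_count X n \<omega> i) / real n"
      using elim \<pi>_pos[of i] by (auto intro: order_tendstoD)
    then show ?thesis by (rule eventually_mono) (metis div_0 less_irrefl of_nat_0)
  qed
  then show ?case by (rule eventually_all_finite)
qed

lemma P_hat_consistent: "AE \<omega> in M. (\<lambda>n. P_hat X n \<omega>) \<longlonglongrightarrow> P"
proof -
  have "AE \<omega> in M. \<forall>ij\<in>UNIV. (\<lambda>n. transition_sum (deviation (fst ij) (snd ij)) n \<omega> / real n) \<longlonglongrightarrow> 0"
    by (intro AE_finite_allI transition_sum_strong_law centred_deviation) simp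
  with inverse_visit_frequency eventually_all_visited show ?thesis
  proof eventually_elim
    case (elim \<omega>)
    have "(\<lambda>n. P_hat X n \<omega> $ i $ j) \<longlonglongrightarrow> P $ i $ j" for i j
    proof -
      have "(\<lambda>n. P $ i $ j + (transition_sum (deviation i j) n \<omega> / real n) * (\<chi> i. real n / real (visit_count X n \<omega> i)) $ i)
         \<longlonglongrightarrow> P $ i $ j + 0 * (\<chi> i. inverse (\<pi> $ i)) $ i"
        using elim(3) by (intro tendsto_intros elim(1)) (auto dest: bspec[where x="(i, j)"])
      moreover have "\<forall>\<^sub>F n in sequentially. P $ i $ j + (transition_sum (deviation i j) n \<omega> / real n) *
          (\<chi> i. real n / real (visit_count X n \<omega> i)) $ i = P_hat X n \<omega> $ i $ j"
        using elim(2) eventually_gt_at_top[of 0]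
      proof eventually_elim
        case (elim n)
        then show ?case using P_hat_error[of n \<omega> i j] by (simp add: field_simps)
      qed
      ultimately show ?thesis by (simp add: tendsto_cong)
    qed
    then show ?case by (intro vec_tendstoI)
  qed
qed

text \<open>Replacing \<open>g\<close> by its conditional mean given the present state costs a martingale, and what
  remains is an average over the visited states.\<close>

lemma pair_ergodic:
  "AE \<omega> in M. (\<lambda>n. transition_sum g n \<omega> / real n) \<longlonglongrightarrow> (\<Sum>i\<in>UNIV. \<pi> $ i * (\<Sum>j\<in>UNIV. P $ i $ j * g i j))"
proof -
  define gbar where "gbar i = (\<Sum>j\<in>UNIV. P $ i $ j * g i j)" for i
  have "centred (\<lambda>x y. g x y - gbar x)"
    by (simp add: centred_def right_diff_distrib sum_subtractf gbar_def sum_distrib_right[symmetric] P_sum)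
  from transition_sum_strong_law[OF this] visit_frequency show ?thesis
  proof eventually_elim
    case (elim \<omega>)
    have "transition_sum (\<lambda>x y. gbar x) n \<omega> = (\<Sum>i\<in>UNIV. real (visit_count X n \<omega> i) * gbar i)" for n
    proof -
      have "gbar x = (\<Sum>i\<in>UNIV. gbar i * of_bool (x = i))" for x
      proof -
        have "(\<Sum>i\<in>UNIV. gbar i * of_bool (x = i)) = (\<Sum>i\<in>UNIV. if x = i then gbar i else 0)"
          by (intro sum.cong) auto
        then show ?thesis by simp
      qed
      then have "transition_sum (\<lambda>x y. gbar x) n \<omega> = transition_sum (\<lambda>x y. \<Sum>i\<in>UNIV. gbar i * of_bool (x = i)) n \<omega>" by simp
      then show ?thesis
        by (simp only: visit_count_psum transition_sum_sum transition_sum_scale) (simp only: mult.commute)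
    qed
    then have "transition_sum g n \<omega> / real n = transition_sum (\<lambda>x y. g x y - gbar x) n \<omega> / real n +
       (\<Sum>i\<in>UNIV. real (visit_count X n \<omega> i) / real n * gbar i)" for n
      by (simp add: transition_sum_diff diff_divide_distrib sum_divide_distrib)
    moreover have "(\<lambda>n. transition_sum (\<lambda>x y. g x y - gbar x) n \<omega> / real n +
       (\<Sum>i\<in>UNIV. real (visit_count X n \<omega> i) / real n * gbar i)) \<longlonglongrightarrow> 0 + (\<Sum>i\<in>UNIV. \<pi> $ i * gbar i)"
      using elim by (intro tendsto_intros) auto
    ultimately show ?case by (simp add: gbar_def)
  qed
qed

end

section \<open>The central limit theorem for transition sums\<close>

lemma one_plus_i_exp_bound:
  fixes x :: real
  shows "norm (1 + \<i> * of_real x) \<le> exp (x\<^sup>2 / 2)"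
proof -
  have "(norm (1 + \<i> * of_real x))\<^sup>2 = 1 + x\<^sup>2"
    by (simp add: cmod_power2)
  also have "\<dots> \<le> exp (x\<^sup>2)" by (rule exp_ge_add_one_self)
  also have "\<dots> = (exp (x\<^sup>2 / 2))\<^sup>2" by (simp add: power2_eq_square exp_add[symmetric])
  finally show ?thesis by (rule power2_le_imp_le) simp
qed

lemma one_plus_i_ge_one:
  fixes x :: real
  shows "1 \<le> norm (1 + \<i> * of_real x)"
  using abs_Re_le_cmod[of "1 + \<i> * of_real x"] by simp

lemma Re_cis_mult_iexp: "Re (cis b * iexp y) = cos (y + b)"
  by (simp add: cis_conv_exp[symmetric] cis_mult add.commute)

text \<open>What is left of \<open>e\<^sup>i\<^sup>x\<close> after the martingale factor \<open>1 + i x\<close> is split off; close to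
  \<open>exp (- x\<^sup>2 / 2)\<close> for small \<open>x\<close>.\<close>

definition corrector :: "real \<Rightarrow> complex" where
  "corrector x = iexp x / (1 + \<i> * of_real x)"

lemma iexp_eq_corrector: "iexp x = (1 + \<i> * of_real x) * corrector x"
  using one_plus_i_ge_one[of x] by (auto simp: corrector_def)

lemma norm_corrector_le: "norm (corrector x) \<le> 1"
  using one_plus_i_ge_one[of x] by (simp add: corrector_def norm_divide divide_simps)

text \<open>Both \<open>e\<^sup>i\<^sup>x\<close> and \<open>(1 + i x) exp (- x\<^sup>2 / 2)\<close> agree with \<open>1 + i x - x\<^sup>2 / 2\<close> up to
  third order, and division by \<open>1 + i x\<close> does not increase norms.\<close>

lemma corrector_approx:
  fixes x :: real
  assumes "\<bar>x\<bar> \<le> 1"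
  shows "norm (corrector x - of_real (exp (- x\<^sup>2 / 2))) \<le> 2 * \<bar>x\<bar> ^ 3"
proof -
  define y where "y = x\<^sup>2 / 2"
  have "x\<^sup>2 \<le> 1" using assms by (simp add: abs_square_le_1)
  then have y: "0 \<le> y" "y \<le> 1" by (auto simp: y_def)
  define r where "r = exp (- y) - (1 - y)"
  have r: "0 \<le> r" "r \<le> y\<^sup>2"
  proof -
    show "0 \<le> r" using exp_ge_add_one_self[of "- y"] by (simp add: r_def)
    have "exp (- y) \<le> 1 / (1 + y)"
      using exp_ge_add_one_self[of y] y by (simp add: exp_minus field_simps)
    also have "\<dots> \<le> 1 - y + y\<^sup>2"
      using y by (simp add: field_simps power2_eq_square) 
    finally show "r \<le> y\<^sup>2" by (simp add: r_def)
  qed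
  have "(\<Sum>k\<le>2. (\<i> * of_real x) ^ k / fact k) = 1 + \<i> * of_real x - of_real y"
    by (simp add: numeral_2_eq_2 y_def power2_eq_square mult_ac)
  with iexp_approx1[of x 2]
  have t: "norm (iexp x - (1 + \<i> * of_real x - of_real y)) \<le> \<bar>x\<bar> ^ 3 / 6"
    by (simp add: numeral_3_eq_3 fact_numeral numeral_2_eq_2)
  have e: "(1 + \<i> * of_real x) * of_real (exp (- y)) - (1 + \<i> * of_real x - of_real y) =
     (1 + \<i> * of_real x) * of_real r - \<i> * of_real x * of_real y"
    by (simp add: r_def algebra_simps)
  have y2: "y\<^sup>2 \<le> \<bar>x\<bar> ^ 3 / 4"
  proof -
    have "y\<^sup>2 = (\<bar>x\<bar> ^ 3 / 4) * \<bar>x\<bar>" by (simp add: y_def power2_eq_square power3_eq_cube)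
    also have "\<dots> \<le> (\<bar>x\<bar> ^ 3 / 4) * 1" using assms by (intro mult_left_mono) auto
    finally show ?thesis by simp
  qed
  have "norm ((1 + \<i> * of_real x) * of_real r - \<i> * of_real x * of_real y) \<le>
     norm ((1 + \<i> * of_real x) * of_real r :: complex) + norm (\<i> * of_real x * of_real y :: complex)"
    by (rule norm_triangle_ineq4)
  also have "\<dots> \<le> 2 * r + \<bar>x\<bar> * y"
  proof -
    have "norm (1 + \<i> * of_real x) \<le> 2"
      using norm_triangle_ineq[of 1 "\<i> * of_real x"] assms by (simp add: norm_mult)
    then show ?thesis using r(1) y(1) by (simp add: norm_mult mult_right_mono)
  qed
  also have "\<dots> \<le> \<bar>x\<bar> ^ 3"
    using r(2) y2 by (simp add: y_def power2_eq_square power3_eq_cube)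
  finally have "norm ((1 + \<i> * of_real x) * of_real (exp (- y)) - (1 + \<i> * of_real x - of_real y)) \<le> \<bar>x\<bar> ^ 3"
    unfolding e .
  moreover have "norm (iexp x - (1 + \<i> * of_real x) * of_real (exp (- y))) \<le>
      norm (iexp x - (1 + \<i> * of_real x - of_real y)) +
      norm ((1 + \<i> * of_real x) * of_real (exp (- y)) - (1 + \<i> * of_real x - of_real y))"
    by (rule order_trans[OF _ norm_triangle_ineq4]) simp
  moreover have "0 \<le> \<bar>x\<bar> ^ 3" by simp
  ultimately have main: "norm (iexp x - (1 + \<i> * of_real x) * of_real (exp (- y))) \<le> 2 * \<bar>x\<bar> ^ 3"
    using t by linarith
  have nz: "1 + \<i> * of_real x \<noteq> 0" using one_plus_i_ge_one[of x] by auto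
  have "corrector x - of_real (exp (- y)) = (iexp x - (1 + \<i> * of_real x) * of_real (exp (- y))) / (1 + \<i> * of_real x)"
    using nz by (simp add: corrector_def field_simps)
  then have "norm (corrector x - of_real (exp (- y))) \<le> norm (iexp x - (1 + \<i> * of_real x) * of_real (exp (- y)))"
    using one_plus_i_ge_one[of x] by (simp add: norm_divide) (simp add: divide_simps mult_left_mono mult_le_cancel_left1)
  with main show ?thesis by (simp add: y_def)
qed

text \<open>All factors have norm at most one, so the products differ by at most the sum of the \<open>n\<close> differences of the factors,
  each of order \<open>n\<^sup>-\<^sup>3\<^sup>/\<^sup>2\<close>.\<close>

lemma corrector_product_limit:
  fixes x :: "nat \<Rightarrow> real"
  assumes bound: "\<And>t. \<bar>x t\<bar> \<le> B"
    and sq: "(\<lambda>n. (\<Sum>t<n. (x t)\<^sup>2) / real n) \<longlonglongrightarrow> v"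
  shows "(\<lambda>n. \<Prod>t<n. corrector (x t / sqrt (real n))) \<longlonglongrightarrow> of_real (exp (- v / 2))"
proof -
  have B0: "0 \<le> B" using bound[of 0] by linarith
  let ?C = "\<lambda>n. \<Prod>t<n. corrector (x t / sqrt (real n))"
  let ?E = "\<lambda>n. \<Prod>t<n. complex_of_real (exp (- (x t / sqrt (real n))\<^sup>2 / 2))"
  have "(\<lambda>n. ?C n - ?E n) \<longlonglongrightarrow> 0"
  proof (rule Lim_null_comparison)
    show "(\<lambda>n. 2 * B ^ 3 * inverse (sqrt (real n))) \<longlonglongrightarrow> 0"
      by (intro tendsto_mult_right_zero tendsto_inverse_0_at_top
          filterlim_compose[OF sqrt_at_top filterlim_real_sequentially])
    have ev: "\<forall>\<^sub>F n in sequentially. B \<le> sqrt (real n) \<and> 0 < n"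
      by (intro eventually_conj eventually_gt_at_top
         filterlim_compose[OF sqrt_at_top filterlim_real_sequentially, unfolded filterlim_at_top, rule_format])
    show "\<forall>\<^sub>F n in sequentially. norm (?C n - ?E n) \<le> 2 * B ^ 3 * inverse (sqrt (real n))"
      using ev
    proof eventually_elim
      case (elim n)
      define s where "s = sqrt (real n)"
      have s: "0 < s" "B \<le> s" "s * s = real n" using elim by (auto simp: s_def)
      have "norm (?C n - ?E n) \<le> (\<Sum>t<n. norm (corrector (x t / s) - complex_of_real (exp (- (x t / s)\<^sup>2 / 2))))"
        unfolding s_def by (rule norm_prod_diff) (simp_all add: norm_corrector_le)
      also have "\<dots> \<le> (\<Sum>t<n. 2 * (B / s) ^ 3)"
      proof (rule sum_mono)
        fix t
        have "\<bar>x t / s\<bar> \<le> B / s" using bound[of t] s by (simp add: divide_right_mono)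
        moreover have "B / s \<le> 1" using s by simp
        ultimately show "norm (corrector (x t / s) - complex_of_real (exp (- (x t / s)\<^sup>2 / 2))) \<le> 2 * (B / s) ^ 3"
          by (intro order_trans[OF corrector_approx] mult_left_mono power_mono) linarith+
      qed
      also have "\<dots> = (s * s) * (2 * (B / s) ^ 3)" by (simp add: s(3))
      also have "\<dots> = 2 * B ^ 3 * inverse s" using s(1) by (simp add: field_simps power3_eq_cube)
      finally show ?case by (simp add: s_def)
    qed
  qed
  moreover have "?E \<longlonglongrightarrow> of_real (exp (- v / 2))"
  proof -
    have "?E n = of_real (exp (- ((\<Sum>t<n. (x t)\<^sup>2) / real n) / 2))" for n
      by (simp add: exp_sum[symmetric] of_real_prod[symmetric] sum_negf sum_divide_distrib power_divide
        del: of_real_prod)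
    then show ?thesis by (simp only:) (intro tendsto_intros sq, simp)
  qed
  ultimately show ?thesis using tendsto_add by fastforce
qed

context finite_chain begin

definition exp_martingale :: "('s \<Rightarrow> 's \<Rightarrow> real) \<Rightarrow> real \<Rightarrow> nat \<Rightarrow> 'a \<Rightarrow> complex" where
  "exp_martingale d \<theta> n \<omega> = (\<Prod>t<n. 1 + \<i> * of_real (\<theta> * d (X t \<omega>) (X (Suc t) \<omega>)))"

lemma integrable_exp_martingale: "integrable M (exp_martingale d \<theta> n)"
  using integrable_history[of "\<lambda>h. \<Prod>t<n. 1 + \<i> * of_real (\<theta> * d (h t) (h (Suc t)))" n]
  by (simp add: exp_martingale_def[abs_def])

text \<open>Each new factor is one plus a multiple of a martingale difference.\<close>

lemma expectation_exp_martingale: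
  assumes "centred d" shows "(\<integral>\<omega>. exp_martingale d \<theta> n \<omega> \<partial>M) = 1"
proof (induction n)
  case 0 show ?case by (simp add: exp_martingale_def prob_space)
next
  case (Suc n)
  let ?F = "\<lambda>h. \<i> * of_real \<theta> * (\<Prod>t<n. 1 + \<i> * of_real (\<theta> * d (h t) (h (Suc t))))"
  have eq: "exp_martingale d \<theta> (Suc n) \<omega> = exp_martingale d \<theta> n \<omega> + d (X n \<omega>) (X (Suc n) \<omega>) *\<^sub>R ?F (history n \<omega>)" for \<omega>
    by (simp add: exp_martingale_def scaleR_conv_of_real algebra_simps)
  have "integrable M (\<lambda>\<omega>. d (X n \<omega>) (X (Suc n) \<omega>) *\<^sub>R ?F (history n \<omega>))"
    using integrable_history[of "\<lambda>h. d (h n) (h (Suc n)) *\<^sub>R ?F h" "Suc n"] by simp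
  then show ?case
    unfolding eq using Suc.IH expectation_centred[OF assms, of n ?F]
    by (simp add: integrable_exp_martingale)
qed

text \<open>The modulus of \<open>1 + i x\<close> exceeds one only to second order, so for \<open>\<theta> = 1 / \<surd>n\<close> the product stays bounded
  uniformly in \<open>n\<close>. This is what allows the almost sure limit of the other factor to be taken under the integral.\<close>

lemma norm_exp_martingale_le:
  assumes B: "\<And>i j. \<bar>d i j\<bar> \<le> B"
  shows "norm (exp_martingale d \<theta> n \<omega>) \<le> exp (real n * (\<theta> * B)\<^sup>2 / 2)"
proof -
  have "norm (exp_martingale d \<theta> n \<omega>) = (\<Prod>t<n. norm (1 + \<i> * of_real (\<theta> * d (X t \<omega>) (X (Suc t) \<omega>))))"
    unfolding exp_martingale_def by (rule prod_norm[symmetric])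
  also have "\<dots> \<le> (\<Prod>t<n. exp ((\<theta> * B)\<^sup>2 / 2))"
  proof (rule prod_mono, intro conjI norm_ge_zero order_trans[OF one_plus_i_exp_bound])
    fix t
    have "\<bar>\<theta> * d (X t \<omega>) (X (Suc t) \<omega>)\<bar> \<le> \<bar>\<theta> * B\<bar>"
      unfolding abs_mult by (intro mult_left_mono order_trans[OF B abs_ge_self]) simp
    then show "exp ((\<theta> * d (X t \<omega>) (X (Suc t) \<omega>))\<^sup>2 / 2) \<le> exp ((\<theta> * B)\<^sup>2 / 2)"
      by (simp add: abs_le_square_iff)
  qed
  also have "\<dots> = exp (real n * ((\<theta> * B)\<^sup>2 / 2))" 
    by (simp only: exp_of_nat_mult prod_constant card_lessThan)
  finally show ?thesis by simp
qed

end

context ergodic_chain begin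

definition asymp_variance :: "('s \<Rightarrow> 's \<Rightarrow> real) \<Rightarrow> real" where
  "asymp_variance d = (\<Sum>i\<in>UNIV. \<pi> $ i * (\<Sum>j\<in>UNIV. P $ i $ j * (d i j)\<^sup>2))"

text \<open>As \<open>E Q = 1\<close>, the characteristic function \<open>E (Q U)\<close> differs from the constant limit \<open>c\<close> of \<open>U\<close>
  by \<open>E (Q (U - c))\<close>, which tends to zero by dominated convergence.\<close>

lemma transition_sum_char_limit:
  assumes d: "centred d"
  shows "(\<lambda>n. \<integral>\<omega>. iexp (transition_sum d n \<omega> / sqrt (real n)) \<partial>M) \<longlonglongrightarrow> of_real (exp (- asymp_variance d / 2))"
proof -
  obtain B where B: "\<And>i j. \<bar>d i j\<bar> \<le> B" using bounded_increments[of d] by blast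
  define c where "c = complex_of_real (exp (- asymp_variance d / 2))"
  define U where "U n \<omega> = (\<Prod>t<n. corrector (d (X t \<omega>) (X (Suc t) \<omega>) / sqrt (real n)))" for n \<omega>
  define Q where "Q n = exp_martingale d (1 / sqrt (real n)) n" for n
  have [measurable]: "Q n \<in> borel_measurable M" for n
    unfolding Q_def using integrable_exp_martingale by (rule borel_measurable_integrable)
  have [measurable]: "U n \<in> borel_measurable M" for n
    using integrable_history[of "\<lambda>h. \<Prod>t<n. corrector (d (h t) (h (Suc t)) / sqrt (real n))" n, THEN borel_measurable_integrable]
    by (simp add: U_def[abs_def])
  have factor: "iexp (transition_sum d n \<omega> / sqrt (real n)) = Q n \<omega> * U n \<omega>" for n \<omega>
  proof -
    have "iexp (transition_sum d n \<omega> / sqrt (real n)) = (\<Prod>t<n. iexp (d (X t \<omega>) (X (Suc t) \<omega>) / sqrt (real n)))"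
      by (simp add: transition_sum_def sum_divide_distrib exp_sum[symmetric] sum_distrib_left)
    also have "\<dots> = Q n \<omega> * U n \<omega>"
      unfolding iexp_eq_corrector prod.distrib by (simp add: Q_def U_def exp_martingale_def)
    finally show ?thesis .
  qed
  have normQ: "norm (Q n \<omega>) \<le> exp (B\<^sup>2 / 2)" for n \<omega>
  proof -
    have "norm (Q n \<omega>) \<le> exp (real n * (1 / sqrt (real n) * B)\<^sup>2 / 2)"
      unfolding Q_def by (rule norm_exp_martingale_le[OF B])
    also have "\<dots> \<le> exp (B\<^sup>2 / 2)" by (cases "n = 0") (simp_all add: power_mult_distrib power_divide)
    finally show ?thesis .
  qed
  have normU: "norm (U n \<omega>) \<le> 1" for n \<omega>
    unfolding U_def prod_norm[symmetric] by (intro prod_le_1) (simp add: norm_corrector_le)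
  have normc: "norm c \<le> 1"
  proof -
    have "0 \<le> asymp_variance d" unfolding asymp_variance_def
      by (intro sum_nonneg mult_nonneg_nonneg less_imp_le[OF \<pi>_pos] P_nonneg) simp
    then show ?thesis by (simp add: c_def)
  qed
  have "(\<lambda>n. \<integral>\<omega>. Q n \<omega> * (U n \<omega> - c) \<partial>M) \<longlonglongrightarrow> (\<integral>\<omega>. 0 \<partial>M)"
  proof (rule integral_dominated_convergence[where w="\<lambda>_. exp (B\<^sup>2 / 2) * 2"])
    have "AE \<omega> in M. (\<lambda>n. transition_sum (\<lambda>x y. (d x y)\<^sup>2) n \<omega> / real n) \<longlonglongrightarrow> asymp_variance d"
      unfolding asymp_variance_def by (rule pair_ergodic)
    then show "AE \<omega> in M. (\<lambda>n. Q n \<omega> * (U n \<omega> - c)) \<longlonglongrightarrow> 0"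
    proof eventually_elim
      case (elim \<omega>)
      have "(\<lambda>n. U n \<omega>) \<longlonglongrightarrow> c"
        unfolding U_def c_def
        by (rule corrector_product_limit[OF B]) (use elim in \<open>simp add: transition_sum_def\<close>)
      then have U: "(\<lambda>n. exp (B\<^sup>2 / 2) * norm (U n \<omega> - c)) \<longlonglongrightarrow> 0"
        by (intro tendsto_mult_right_zero tendsto_norm_zero) (simp add: LIM_zero)
      show ?case
        by (rule Lim_null_comparison[OF always_eventually U])
           (auto simp: norm_mult intro!: mult_right_mono normQ)
    qed
    show "AE \<omega> in M. norm (Q n \<omega> * (U n \<omega> - c)) \<le> exp (B\<^sup>2 / 2) * 2" for n
      unfolding norm_mult
      by (intro AE_I2 mult_mono normQ order_trans[OF norm_triangle_ineq4] order_trans[OF add_mono[OF normU normc]]) auto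
  qed simp_all
  then have "(\<lambda>n. (\<integral>\<omega>. Q n \<omega> * (U n \<omega> - c) \<partial>M) + c) \<longlonglongrightarrow> 0 + c" by (intro tendsto_add) simp_all
  moreover have "(\<integral>\<omega>. Q n \<omega> * (U n \<omega> - c) \<partial>M) + c = (\<integral>\<omega>. iexp (transition_sum d n \<omega> / sqrt (real n)) \<partial>M)" for n
  proof -
    have "integrable M (\<lambda>\<omega>. Q n \<omega> * U n \<omega>)"
      using integrable_history[of "\<lambda>h. iexp ((\<Sum>t<n. d (h t) (h (Suc t))) / sqrt (real n))" n]
      by (simp add: factor[symmetric] transition_sum_def)
    moreover have "integrable M (Q n)" "(\<integral>\<omega>. Q n \<omega> \<partial>M) = 1"
      unfolding Q_def by (rule integrable_exp_martingale, rule expectation_exp_martingale[OF d])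
    ultimately show ?thesis unfolding factor by (simp add: right_diff_distrib)
  qed
  ultimately show ?thesis by (simp add: c_def)
qed

lemma transition_sum_cos_limit:
  assumes d: "centred d"
  shows "(\<lambda>n. \<integral>\<omega>. cos (transition_sum d n \<omega> / sqrt (real n) + b) \<partial>M) \<longlonglongrightarrow> cos b * exp (- asymp_variance d / 2)"
proof -
  have "(\<lambda>n. Re (cis b * (\<integral>\<omega>. iexp (transition_sum d n \<omega> / sqrt (real n)) \<partial>M))) \<longlonglongrightarrow>
     Re (cis b * of_real (exp (- asymp_variance d / 2)))"
    by (intro tendsto_intros transition_sum_char_limit d)
  moreover have "Re (cis b * (\<integral>\<omega>. iexp (transition_sum d n \<omega> / sqrt (real n)) \<partial>M)) =
      (\<integral>\<omega>. cos (transition_sum d n \<omega> / sqrt (real n) + b) \<partial>M)" for n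
  proof -
    have int: "integrable M (\<lambda>\<omega>. iexp (transition_sum d n \<omega> / sqrt (real n)))"
      using integrable_history[of "\<lambda>h. iexp ((\<Sum>t<n. d (h t) (h (Suc t))) / sqrt (real n))" n]
      by (simp add: transition_sum_def)
    have "Re (cis b * (\<integral>\<omega>. iexp (transition_sum d n \<omega> / sqrt (real n)) \<partial>M)) =
      (\<integral>\<omega>. Re (cis b * iexp (transition_sum d n \<omega> / sqrt (real n))) \<partial>M)"
      using int by (subst integral_Re) simp_all
    then show ?thesis by (simp only: Re_cis_mult_iexp)
  qed
  ultimately show ?thesis by simp
qed

end

section \<open>Linear functionals of the Gaussian matrix\<close>

lemma sum_UNIV_prod: "(\<Sum>p\<in>UNIV. f p) = (\<Sum>i\<in>UNIV. \<Sum>j\<in>UNIV. f (i, j))"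
  unfolding UNIV_Times_UNIV[symmetric] sum.cartesian_product by simp

lemma cartesian_inner: fixes u w :: "real^'s^'s" shows "u \<bullet> w = vec_mat (transpose u) \<bullet> vec_mat (transpose w)"
proof -
  have "(\<Sum>i\<in>UNIV. \<Sum>j\<in>UNIV. u $ i $ j * w $ i $ j) = (\<Sum>p\<in>UNIV. u $ fst p $ snd p * w $ fst p $ snd p)"
    by (simp add: sum_UNIV_prod)
  then show ?thesis by (simp add: inner_vec_def vec_mat_def transpose_def)
qed

lemma bilinear_eq_kron_vec:
  "(a v* B) \<bullet> c = kron_vec a c \<bullet> vec_mat (transpose B)"
proof -
  have "(a v* B) \<bullet> c = (\<Sum>j\<in>UNIV. \<Sum>i\<in>UNIV. a $ i * c $ j * B $ i $ j)"
    by (simp add: inner_vec_def vector_matrix_mult_def sum_distrib_left mult_ac)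
  also have "\<dots> = (\<Sum>i\<in>UNIV. \<Sum>j\<in>UNIV. a $ i * c $ j * B $ i $ j)" by (rule sum.swap)
  also have "\<dots> = (\<Sum>p\<in>UNIV. a $ fst p * c $ snd p * B $ fst p $ snd p)"
    by (simp add: sum_UNIV_prod)
  finally show ?thesis by (simp add: inner_vec_def vec_mat_def transpose_def kron_vec_def)
qed

lemma transpose_sum: "transpose (\<Sum>i\<in>I. f i :: real^'s^'s) = (\<Sum>i\<in>I. transpose (f i))"
  by (simp add: vec_eq_iff transpose_def)

lemma vec_mat_sum: "vec_mat (\<Sum>i\<in>I. f i) = (\<Sum>i\<in>I. vec_mat (f i))"
  by (simp add: vec_eq_iff vec_mat_def)

lemma matrix_vector_mult_sum: "(\<Sum>i\<in>I. A i :: real^'n^'m) *v x = (\<Sum>i\<in>I. A i *v x)"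
  by (simp add: vec_eq_iff matrix_vector_mult_def sum_distrib_right) (auto intro: sum.swap)

text \<open>The identity \<open>vec (A B C) = (C\<^sup>T \<otimes> A) vec B\<close>, applied to the transposed summands of \<open>W_pow\<close>.\<close>

lemma W_pow_functional:
  "(a v* W_pow P W k) \<bullet> c = (kron_vec a c v* M_mat P k) \<bullet> vec_mat (transpose W)"
proof -
  have "vec_mat (transpose (W_pow P W k)) = M_mat P k *v vec_mat (transpose W)"
    by (simp add: W_pow_def M_mat_def transpose_sum vec_mat_sum matrix_vector_mult_sum matrix_transpose_mul
      matrix_mul_assoc vec_mat_mult_eq_kron)
  then show ?thesis
    unfolding bilinear_eq_kron_vec[of a "W_pow P W k" c] by (simp add: dot_lmul_matrix)
qed

lemma integral_normal_law:
  assumes "0 < \<sigma>" and [measurable]: "f \<in> borel_measurable borel"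
  shows "(\<integral>x. f x \<partial>normal_law \<mu> \<sigma>) = (\<integral>x. normal_density \<mu> \<sigma> x * (f x :: real) \<partial>lborel)"
    and "integrable (normal_law \<mu> \<sigma>) f \<longleftrightarrow> integrable lborel (\<lambda>x. normal_density \<mu> \<sigma> x * f x)"
  using assms by (simp_all add: normal_law_def integral_density integrable_density)

lemma sets_normal_law [simp, measurable_cong]: "sets (normal_law \<mu> \<sigma>) = sets borel"
  by (simp add: normal_law_def)

text \<open>The case \<open>\<sigma> = 0\<close> is the point mass and has to be treated apart from the densities.\<close>

lemma normal_law_moments:
  assumes "0 \<le> \<sigma>"
  shows "integrable (normal_law \<mu> \<sigma>) (\<lambda>x. x)" "(\<integral>x. x \<partial>normal_law \<mu> \<sigma>) = \<mu>"
    "integrable (normal_law \<mu> \<sigma>) (\<lambda>x. (x - \<mu>)\<^sup>2)" "(\<integral>x. (x - \<mu>)\<^sup>2 \<partial>normal_law \<mu> \<sigma>) = \<sigma>\<^sup>2"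
proof -
  have "integrable (return borel \<mu>) (g :: real \<Rightarrow> real)" if [measurable]: "g \<in> borel_measurable borel" for g
  proof -
    interpret prob_space "return borel \<mu>" by (rule prob_space_return) simp
    show ?thesis
      by (rule integrable_const_bound[where B="norm (g \<mu>)"]) (simp_all add: AE_return)
  qed
  note ret = this
  consider "\<sigma> = 0" | "0 < \<sigma>" using assms by linarith
  then have "integrable (normal_law \<mu> \<sigma>) (\<lambda>x. x) \<and> (\<integral>x. x \<partial>normal_law \<mu> \<sigma>) = \<mu> \<and>
    integrable (normal_law \<mu> \<sigma>) (\<lambda>x. (x - \<mu>)\<^sup>2) \<and> (\<integral>x. (x - \<mu>)\<^sup>2 \<partial>normal_law \<mu> \<sigma>) = \<sigma>\<^sup>2"
  proof cases
    case 1
    then show ?thesis by (simp add: normal_law_def integral_return ret)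
  next
    case 2
    then show ?thesis
      using integrable_normal_moment_nz_1[of \<sigma> \<mu>] integrable_normal_moment[of \<sigma> \<mu> 2]
        integral_normal_moment_even[of \<sigma> \<mu> 1] normal_moment_nz_1[of \<sigma> \<mu>]
      by (simp add: integral_normal_law has_bochner_integral_iff)
  qed
  then show "integrable (normal_law \<mu> \<sigma>) (\<lambda>x. x)" "(\<integral>x. x \<partial>normal_law \<mu> \<sigma>) = \<mu>"
    "integrable (normal_law \<mu> \<sigma>) (\<lambda>x. (x - \<mu>)\<^sup>2)" "(\<integral>x. (x - \<mu>)\<^sup>2 \<partial>normal_law \<mu> \<sigma>) = \<sigma>\<^sup>2" by auto
qed

lemma normal_law_cos:
  assumes "0 \<le> \<sigma>"
  shows "(\<integral>x. cos (x + b) \<partial>normal_law 0 \<sigma>) = cos b * exp (- \<sigma>\<^sup>2 / 2)"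
proof (cases "\<sigma> = 0")
  case True
  then show ?thesis by (simp add: normal_law_def integral_return)
next
  case False
  with assms have s: "0 < \<sigma>" by simp
  interpret S: prob_space std_normal_distribution by (rule prob_space_normal_density) simp
  have scale: "\<sigma> * normal_density 0 \<sigma> (\<sigma> * x) = std_normal_density x" for x
    using s by (simp add: normal_density_def power_mult_distrib real_sqrt_mult)
  have "(\<integral>x. cos (x + b) \<partial>normal_law 0 \<sigma>) = (\<integral>x. normal_density 0 \<sigma> x * cos (x + b) \<partial>lborel)"
    using s by (simp add: integral_normal_law)
  also have "\<dots> = \<bar>\<sigma>\<bar> *\<^sub>R (\<integral>x. normal_density 0 \<sigma> (0 + \<sigma> * x) * cos (0 + \<sigma> * x + b) \<partial>lborel)"
    using s by (intro lborel_integral_real_affine) simp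
  also have "\<dots> = (\<integral>x. std_normal_density x * cos (\<sigma> * x + b) \<partial>lborel)"
    using s by (simp add: scale[symmetric] mult.assoc)
  also have "\<dots> = (\<integral>x. cos (\<sigma> * x + b) \<partial>std_normal_distribution)"
    by (simp add: integral_density)
  also have "\<dots> = (\<integral>x. Re (cis b * iexp (\<sigma> * x)) \<partial>std_normal_distribution)"
    by (simp only: Re_cis_mult_iexp)
  also have "\<dots> = Re (cis b * char std_normal_distribution \<sigma>)"
  proof -
    have "integrable std_normal_distribution (\<lambda>x. iexp (\<sigma> * x))"
      by (rule S.integrable_const_bound[where B=1]) simp_all
    then have "(\<integral>x. Re (cis b * iexp (\<sigma> * x)) \<partial>std_normal_distribution) =
        Re (\<integral>x. cis b * iexp (\<sigma> * x) \<partial>std_normal_distribution)"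
      by (intro integral_Re integrable_mult_right)
    also have "(\<integral>x. cis b * iexp (\<sigma> * x) \<partial>std_normal_distribution) = cis b * char std_normal_distribution \<sigma>"
      unfolding char_def by (rule integral_mult_right_zero)
    finally show ?thesis .
  qed
  also have "\<dots> = cos b * exp (- \<sigma>\<^sup>2 / 2)" by (simp add: char_std_normal_distribution)
  finally show ?thesis .
qed

text \<open>The law of a linear functional is normal by definition; its two parameters are identified by computing the
  first two moments in both ways.\<close>

lemma gaussian_inner:
  assumes "gaussian N Y"
  shows "integrable N (\<lambda>\<omega>. u \<bullet> Y \<omega>)" "integrable N (\<lambda>\<omega>. (u \<bullet> Y \<omega>)\<^sup>2)"
    "(\<integral>\<omega>. u \<bullet> Y \<omega> \<partial>N) = 0 \<Longrightarrow>
      (\<integral>\<omega>. cos (u \<bullet> Y \<omega> + b) \<partial>N) = cos b * exp (- (\<integral>\<omega>. (u \<bullet> Y \<omega>)\<^sup>2 \<partial>N) / 2)"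
proof -
  have [measurable]: "Y \<in> borel_measurable N" using assms by (simp add: gaussian_def)
  interpret prob_space N using assms by (simp add: gaussian_def)
  obtain \<mu> \<sigma> where \<sigma>: "0 \<le> \<sigma>" and law: "distr N borel (\<lambda>\<omega>. u \<bullet> Y \<omega>) = normal_law \<mu> \<sigma>"
    using assms unfolding gaussian_def by blast
  have transfer: "(\<integral>\<omega>. g (u \<bullet> Y \<omega>) \<partial>N) = (\<integral>x. g x \<partial>normal_law \<mu> \<sigma>)"
      "integrable N (\<lambda>\<omega>. g (u \<bullet> Y \<omega>)) \<longleftrightarrow> integrable (normal_law \<mu> \<sigma>) g"
    if [measurable]: "g \<in> borel_measurable borel" for g :: "real \<Rightarrow> real"
    unfolding law[symmetric]
    by (rule integral_distr[symmetric], measurable) (rule integrable_distr_eq[symmetric], measurable)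
  have meas: "(\<lambda>x. x) \<in> borel_measurable (borel :: real measure)"
    "(\<lambda>x. (x - \<mu>)\<^sup>2) \<in> borel_measurable (borel :: real measure)"
    "(\<lambda>x. cos (x + b)) \<in> borel_measurable (borel :: real measure)"
    by measurable
  show int: "integrable N (\<lambda>\<omega>. u \<bullet> Y \<omega>)"
    by (rule transfer(2)[OF meas(1), THEN iffD2]) (rule normal_law_moments[OF \<sigma>])
  have int2: "integrable N (\<lambda>\<omega>. (u \<bullet> Y \<omega> - \<mu>)\<^sup>2)"
    by (rule transfer(2)[OF meas(2), THEN iffD2]) (rule normal_law_moments[OF \<sigma>])
  have "(u \<bullet> Y \<omega>)\<^sup>2 = (u \<bullet> Y \<omega> - \<mu>)\<^sup>2 + 2 * \<mu> * (u \<bullet> Y \<omega>) - \<mu>\<^sup>2" for \<omega>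
    by (simp add: power2_eq_square algebra_simps)
  moreover have "integrable N (\<lambda>\<omega>. (u \<bullet> Y \<omega> - \<mu>)\<^sup>2 + 2 * \<mu> * (u \<bullet> Y \<omega>) - \<mu>\<^sup>2)"
    by (intro Bochner_Integration.integrable_add Bochner_Integration.integrable_diff int2 integrable_mult_right int) simp
  ultimately show "integrable N (\<lambda>\<omega>. (u \<bullet> Y \<omega>)\<^sup>2)" by (simp only:)
  assume mean: "(\<integral>\<omega>. u \<bullet> Y \<omega> \<partial>N) = 0"
  then have \<mu>: "\<mu> = 0"
    unfolding transfer(1)[OF meas(1)] normal_law_moments(2)[OF \<sigma>] .
  have "(\<integral>\<omega>. (u \<bullet> Y \<omega>)\<^sup>2 \<partial>N) = \<sigma>\<^sup>2"
    using transfer(1)[OF meas(2)] normal_law_moments(4)[OF \<sigma>, of \<mu>] unfolding \<mu> by simp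
  moreover have "(\<integral>\<omega>. cos (u \<bullet> Y \<omega> + b) \<partial>N) = cos b * exp (- \<sigma>\<^sup>2 / 2)"
    using transfer(1)[OF meas(3)] normal_law_cos[OF \<sigma>, of b] unfolding \<mu> by (simp only:)
  ultimately show "(\<integral>\<omega>. cos (u \<bullet> Y \<omega> + b) \<partial>N) = cos b * exp (- (\<integral>\<omega>. (u \<bullet> Y \<omega>)\<^sup>2 \<partial>N) / 2)"
    by (simp only:)
qed

lemma covariance_inner:
  fixes \<xi> :: "'b \<Rightarrow> real^'k"
  assumes int: "\<And>p. integrable N (\<lambda>\<omega>. \<xi> \<omega> $ p)" "\<And>p. (\<integral>\<omega>. \<xi> \<omega> $ p \<partial>N) = 0"
    and sq: "\<And>p. integrable N (\<lambda>\<omega>. (\<xi> \<omega> $ p)\<^sup>2)"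
  shows "(\<integral>\<omega>. x \<bullet> \<xi> \<omega> \<partial>N) = 0"
    and "covariance N (\<lambda>\<omega>. x \<bullet> \<xi> \<omega>) (\<lambda>\<omega>. y \<bullet> \<xi> \<omega>) =
     (x v* (\<chi> p q. covariance N (\<lambda>\<omega>. \<xi> \<omega> $ p) (\<lambda>\<omega>. \<xi> \<omega> $ q))) \<bullet> y"
proof -
  have [measurable]: "(\<lambda>\<omega>. \<xi> \<omega> $ p) \<in> borel_measurable N" for p using int(1) by (rule borel_measurable_integrable)
  have prods: "integrable N (\<lambda>\<omega>. \<xi> \<omega> $ p * \<xi> \<omega> $ q)" for p q
  proof (rule Bochner_Integration.integrable_bound)
    show "integrable N (\<lambda>\<omega>. (\<xi> \<omega> $ p)\<^sup>2 + (\<xi> \<omega> $ q)\<^sup>2)" using sq by simp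
    have "\<bar>r * s\<bar> \<le> r\<^sup>2 + s\<^sup>2" for r s :: real
    proof -
      have "2 * \<bar>r\<bar> * \<bar>s\<bar> \<le> r\<^sup>2 + s\<^sup>2" using sum_squares_bound[of "\<bar>r\<bar>" "\<bar>s\<bar>"] by simp
      moreover have "0 \<le> \<bar>r\<bar> * \<bar>s\<bar>" by simp
      ultimately show ?thesis unfolding abs_mult by linarith
    qed
    then show "AE \<omega> in N. norm (\<xi> \<omega> $ p * \<xi> \<omega> $ q) \<le> norm ((\<xi> \<omega> $ p)\<^sup>2 + (\<xi> \<omega> $ q)\<^sup>2)" by simp
  qed measurable
  show mean: "(\<integral>\<omega>. x \<bullet> \<xi> \<omega> \<partial>N) = 0" for x by (simp add: inner_vec_def int)
  have "covariance N (\<lambda>\<omega>. x \<bullet> \<xi> \<omega>) (\<lambda>\<omega>. y \<bullet> \<xi> \<omega>) =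
    (\<integral>\<omega>. (\<Sum>q\<in>UNIV. \<Sum>p\<in>UNIV. x $ p * y $ q * (\<xi> \<omega> $ p * \<xi> \<omega> $ q)) \<partial>N)"
  proof -
    have "(x \<bullet> z) * (y \<bullet> z) = (\<Sum>q\<in>UNIV. \<Sum>p\<in>UNIV. x $ p * y $ q * (z $ p * z $ q))" for z :: "real^'k"
      unfolding inner_vec_def sum_product by (subst sum.swap) (simp add: mult_ac)
    then show ?thesis by (simp add: covariance_def mean)
  qed
  also have "\<dots> = (\<Sum>q\<in>UNIV. \<Sum>p\<in>UNIV. x $ p * y $ q * (\<integral>\<omega>. \<xi> \<omega> $ p * \<xi> \<omega> $ q \<partial>N))"
    by (simp add: prods)
  also have "\<dots> = (x v* (\<chi> p q. covariance N (\<lambda>\<omega>. \<xi> \<omega> $ p) (\<lambda>\<omega>. \<xi> \<omega> $ q))) \<bullet> y"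
    by (simp add: covariance_def int inner_vec_def vector_matrix_mult_def sum_distrib_left mult_ac)
  finally show "covariance N (\<lambda>\<omega>. x \<bullet> \<xi> \<omega>) (\<lambda>\<omega>. y \<bullet> \<xi> \<omega>) =
     (x v* (\<chi> p q. covariance N (\<lambda>\<omega>. \<xi> \<omega> $ p) (\<lambda>\<omega>. \<xi> \<omega> $ q))) \<bullet> y" .
qed

text \<open>The coordinates of \<open>vec W\<^sup>T\<close> are square integrable because they are themselves linear functionals of the
  Gaussian matrix, so that bilinearity of the covariance applies.\<close>

lemma is_W_functionals:
  assumes W: "is_W P \<pi> N W"
  shows "(\<integral>\<omega>. x \<bullet> vec_mat (transpose (W \<omega>)) \<partial>N) = 0" (is ?mean)
    and "covariance N (\<lambda>\<omega>. x \<bullet> vec_mat (transpose (W \<omega>))) (\<lambda>\<omega>. y \<bullet> vec_mat (transpose (W \<omega>))) =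
     (x v* Sigma_p P \<pi>) \<bullet> y" (is ?cov)
proof -
  have g: "gaussian N W" using W by (simp add: is_W_def)
  have coord: "vec_mat (transpose w) $ p = axis (fst p) (axis (snd p) 1) \<bullet> w" for w :: "real^'c^'c" and p
    by (simp add: vec_mat_def transpose_def inner_axis')
  have int: "integrable N (\<lambda>\<omega>. vec_mat (transpose (W \<omega>)) $ p)"
    and sq: "integrable N (\<lambda>\<omega>. (vec_mat (transpose (W \<omega>)) $ p)\<^sup>2)" for p
    unfolding coord by (rule gaussian_inner[OF g])+
  have mean: "(\<integral>\<omega>. vec_mat (transpose (W \<omega>)) $ p \<partial>N) = 0" for p
    using W by (simp add: is_W_def vec_mat_def transpose_def)
  show ?mean by (rule covariance_inner(1)[OF int mean sq])
  show ?cov unfolding Sigma_p_eq_covariance[OF W] by (rule covariance_inner(2)[OF int mean sq])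
qed

lemma W_cos:
  assumes W: "is_W P \<pi> N W"
  shows "(\<integral>\<omega>. cos (u \<bullet> W \<omega> + b) \<partial>N) =
    cos b * exp (- ((vec_mat (transpose u) v* Sigma_p P \<pi>) \<bullet> vec_mat (transpose u)) / 2)"
proof -
  have g: "gaussian N W" using W by (simp add: is_W_def)
  have mean: "(\<integral>\<omega>. u \<bullet> W \<omega> \<partial>N) = 0" unfolding cartesian_inner by (rule is_W_functionals[OF W])
  have "(\<integral>\<omega>. (u \<bullet> W \<omega>)\<^sup>2 \<partial>N) = covariance N (\<lambda>\<omega>. u \<bullet> W \<omega>) (\<lambda>\<omega>. u \<bullet> W \<omega>)"
    by (simp add: covariance_def mean power2_eq_square)
  also have "\<dots> = (vec_mat (transpose u) v* Sigma_p P \<pi>) \<bullet> vec_mat (transpose u)"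
    unfolding cartesian_inner by (rule is_W_functionals[OF W])
  finally show ?thesis using gaussian_inner(3)[OF g mean] by simp
qed

lemma Z_vec_covariance:
  assumes W: "is_W P \<pi> N W" and "k \<le> m" "l \<le> m"
  shows "covariance N (\<lambda>\<omega>. Z_vec m P a c (W \<omega>) k) (\<lambda>\<omega>. Z_vec m P a c (W \<omega>) l) =
     (kron_vec a c v* (M_mat P k ** Sigma_p P \<pi> ** transpose (M_mat P l))) \<bullet> kron_vec a c"
proof -
  have "covariance N (\<lambda>\<omega>. Z_vec m P a c (W \<omega>) k) (\<lambda>\<omega>. Z_vec m P a c (W \<omega>) l) =
    ((kron_vec a c v* M_mat P k) v* Sigma_p P \<pi>) \<bullet> (kron_vec a c v* M_mat P l)"
    using assms(2,3) by (simp add: Z_vec_def W_pow_functional is_W_functionals(2)[OF W])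
  also have "\<dots> = ((kron_vec a c v* M_mat P k) v* Sigma_p P \<pi> v* transpose (M_mat P l)) \<bullet> kron_vec a c"
    by (subst dot_lmul_matrix) simp
  finally show ?thesis unfolding vector_matrix_mul_assoc .
qed

section \<open>The plug-in estimator\<close>

text \<open>The linear map \<open>V \<mapsto> W_pow P V k\<close> with the left powers taken of \<open>A\<close>. At \<open>A = P\<close> it is the
  derivative of the \<open>k\<close>-th power; at \<open>V = A - P\<close> it is the exact difference of the \<open>k\<close>-th powers.\<close>

definition mixed_power :: "real^'s^'s \<Rightarrow> real^'s^'s \<Rightarrow> real^'s^'s \<Rightarrow> nat \<Rightarrow> real^'s^'s" where
  "mixed_power A P V k = (\<Sum>i<k. matpow A i ** V ** matpow P (k - 1 - i))"

lemma W_pow_eq_mixed_power: "W_pow P V k = mixed_power P P V k"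
  by (simp add: W_pow_def mixed_power_def)

text \<open>Telescoping, one factor \<open>P\<close> replaced at a time.\<close>

lemma matpow_diff:
  fixes A P :: "real^'s^'s"
  shows "matpow A k - matpow P k = mixed_power A P (A - P) k"
proof (induction k)
  case 0
  then show ?case by (simp add: mixed_power_def)
next
  case (Suc k)
  have "mixed_power A P (A - P) (Suc k) =
    (\<Sum>i<k. matpow A i ** (A - P) ** matpow P (k - 1 - i) ** P) + matpow A k ** (A - P)"
  proof -
    have "matpow A i ** (A - P) ** matpow P (Suc k - 1 - i) = matpow A i ** (A - P) ** matpow P (k - 1 - i) ** P"
      if "i < k" for i
    proof -
      have "Suc k - 1 - i = Suc (k - 1 - i)" using that by simp
      then show ?thesis by (simp add: matrix_mul_assoc)
    qed
    then show ?thesis by (simp add: mixed_power_def)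
  qed
  also have "(\<Sum>i<k. matpow A i ** (A - P) ** matpow P (k - 1 - i) ** P) = mixed_power A P (A - P) k ** P"
    by (simp add: mixed_power_def vec_eq_iff matrix_matrix_mult_def sum_distrib_right) (auto intro: sum.swap)
  also have "\<dots> = (matpow A k - matpow P k) ** P" by (simp add: Suc.IH)
  also have "\<dots> + matpow A k ** (A - P) = matpow A (Suc k) - matpow P (Suc k)"
    by (simp add: vec_eq_iff matrix_matrix_mult_def algebra_simps sum.distrib sum_subtractf)
  finally show ?case by simp
qed

lemma continuous_on_matrix_mult [continuous_intros]:
  fixes f g :: "'c::topological_space \<Rightarrow> real^'s^'s"
  assumes "continuous_on S f" "continuous_on S g"
  shows "continuous_on S (\<lambda>x. f x ** g x)"
  unfolding matrix_matrix_mult_def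
  by (intro continuous_intros continuous_on_vec_lambda continuous_on_component assms)

lemma continuous_on_matpow [continuous_intros]:
  fixes f :: "'c::topological_space \<Rightarrow> real^'s^'s"
  assumes "continuous_on S f"
  shows "continuous_on S (\<lambda>x. matpow (f x) k)"
  by (induction k) (auto intro!: continuous_intros assms)

lemma continuous_on_bilinear_form [continuous_intros]:
  fixes f :: "'c::topological_space \<Rightarrow> real^'s^'s"
  assumes "continuous_on S f"
  shows "continuous_on S (\<lambda>x. (a v* f x) \<bullet> c)"
  unfolding inner_vec_def vector_matrix_mult_def
  by (simp, intro continuous_intros continuous_on_component assms)

definition scale_rows :: "real^'s \<Rightarrow> real^'s^'s \<Rightarrow> real^'s^'s" where
  "scale_rows D V = (\<chi> i j. D $ i * V $ i $ j)"

text \<open>The scaled error of the functional as a function of the estimated matrix \<open>A\<close>, of the ratios \<open>D\<^sub>i = n / N\<^sub>i\<close>, and of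
  the normalised martingale \<open>V\<close>.\<close>

definition delta_map ::
  "nat \<Rightarrow> real^'s^'s \<Rightarrow> real^'s \<Rightarrow> real^'s \<Rightarrow> ((real^'s^'s) \<times> (real^'s)) \<Rightarrow> real^'s^'s \<Rightarrow> nat \<Rightarrow> real" where
  "delta_map m P a c = (\<lambda>(A, D) V. \<lambda>k\<in>{..m}. (a v* mixed_power A P (scale_rows D V) k) \<bullet> c)"

lemma delta_map_continuous:
  fixes P :: "real^'s^'s"
  shows "continuous_map euclidean (powertop_real {..m}) (\<lambda>(q, V). delta_map m P a c q V)"
  unfolding continuous_map_componentwise
proof (intro conjI ballI)
  show "(\<lambda>(q, V). delta_map m P a c q V) ` topspace euclidean \<subseteq> extensional {..m}"
    by (auto simp: delta_map_def)
  fix k assume "k \<in> {..m}"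
  then have "(\<lambda>x. (case x of (q, V) \<Rightarrow> delta_map m P a c q V) k) =
     (\<lambda>x. (a v* mixed_power (fst (fst x)) P (scale_rows (snd (fst x)) (snd x)) k) \<bullet> c)"
    by (auto simp: delta_map_def fun_eq_iff split: prod.splits)
  moreover have "continuous_on UNIV (\<lambda>x. (a v* mixed_power (fst (fst x)) P (scale_rows (snd (fst x)) (snd x)) k) \<bullet> c)"
    unfolding mixed_power_def scale_rows_def
    by (intro continuous_intros continuous_on_vec_lambda continuous_on_component)
  ultimately show "continuous_map euclidean euclideanreal (\<lambda>x. (case x of (q, V) \<Rightarrow> delta_map m P a c q V) k)"
    by simp
qed

lemma Gam_error:
  fixes P :: "real^'s^'s"
  assumes "scale_rows D V = r *\<^sub>R (A - P)"
  shows "(\<lambda>k\<in>{..m}. r * (Gam m A a c k - Gam m P a c k)) = delta_map m P a c (A, D) V"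
proof -
  have "r * (Gam m A a c k - Gam m P a c k) = (a v* mixed_power A P (scale_rows D V) k) \<bullet> c" if "k \<le> m" for k
  proof -
    have "r * (Gam m A a c k - Gam m P a c k) = r * ((a v* (matpow A k - matpow P k)) \<bullet> c)"
      using that by (simp add: Gam_def inner_diff_left vec_eq_iff vector_matrix_mult_def algebra_simps sum_subtractf inner_vec_def)
    also have "\<dots> = (a v* (r *\<^sub>R mixed_power A P (A - P) k)) \<bullet> c"
      by (simp add: matpow_diff inner_vec_def vector_matrix_mult_def sum_distrib_left mult_ac)
    also have "r *\<^sub>R mixed_power A P (A - P) k = mixed_power A P (scale_rows D V) k"
      by (simp add: assms mixed_power_def scaleR_sum_right vec_eq_iff matrix_matrix_mult_def sum_distrib_left mult_ac)
    finally show ?thesis .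
  qed
  then show ?thesis by (auto simp: delta_map_def)
qed

lemma Z_vec_eq_delta_map:
  assumes "\<And>i. \<pi> $ i \<noteq> 0"
  shows "Z_vec m P a c W = delta_map m P a c (P, \<chi> i. inverse (\<pi> $ i)) (scale_rows \<pi> W)"
proof -
  have "scale_rows (\<chi> i. inverse (\<pi> $ i)) (scale_rows \<pi> W) = W"
    using assms by (simp add: scale_rows_def vec_eq_iff)
  then show ?thesis by (simp add: Z_vec_def delta_map_def W_pow_eq_mixed_power)
qed

context finite_chain begin

lemma trans_count_history: "trans_count X n \<omega> i j = trans_count (\<lambda>t h. h t) n (history n \<omega>) i j"
  unfolding trans_count_def by (rule arg_cong[where f=card]) auto

lemma visit_count_history: "visit_count X n \<omega> i = visit_count (\<lambda>t h. h t) n (history n \<omega>) i"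
  by (simp add: visit_count_def trans_count_history)

lemma P_hat_history: "P_hat X n \<omega> = P_hat (\<lambda>t h. h t) n (history n \<omega>)"
  unfolding P_hat_def trans_count_history visit_count_history ..

definition score :: "nat \<Rightarrow> 'a \<Rightarrow> real^'s^'s" where
  "score n \<omega> = (\<chi> i j. transition_sum (deviation i j) n \<omega> / sqrt (real n))"

lemma score_measurable [measurable]: "score n \<in> borel_measurable M"
  using integrable_history[of "\<lambda>h. \<chi> i j. (\<Sum>t<n. deviation i j (h t) (h (Suc t))) / sqrt (real n)" n,
    THEN borel_measurable_integrable]
  by (simp add: score_def[abs_def] transition_sum_def)

lemma score_eq_P_hat_error:
  assumes n: "0 < n" and "\<And>i. visit_count X n \<omega> i \<noteq> 0"
  shows "scale_rows (\<chi> i. real n / real (visit_count X n \<omega> i)) (score n \<omega>) = sqrt (real n) *\<^sub>R (P_hat X n \<omega> - P)"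
proof -
  have "real n / v * (s / sqrt (real n)) = sqrt (real n) * (s / v)" for v s :: real
  proof -
    have "real n / v * (s / sqrt (real n)) = (real n / sqrt (real n)) * (s / v)" by simp
    then show ?thesis by (simp add: real_div_sqrt)
  qed
  then show ?thesis
    using P_hat_error[OF assms(2)] by (simp add: vec_eq_iff scale_rows_def score_def)
qed

text \<open>The entries of the score have bounded second moments.\<close>

lemma score_tight: "tight_family M score"
proof (rule tight_family_second_moment)
  let ?B = "2::real"
  have B: "\<bar>deviation i j x y\<bar> \<le> ?B" for i j x y
  proof -
    have "0 \<le> P $ i $ j" "P $ i $ j \<le> (\<Sum>j\<in>UNIV. P $ i $ j)"
      by (rule P_nonneg, rule member_le_sum) (simp_all add: P_nonneg)
    then show ?thesis by (auto simp: deviation_def P_sum)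
  qed
  have norm: "(norm (score n \<omega>))\<^sup>2 = (\<Sum>i\<in>UNIV. \<Sum>j\<in>UNIV. (transition_sum (deviation i j) n \<omega>)\<^sup>2 / real n)" for n \<omega>
    by (simp add: power2_norm_eq_inner inner_vec_def score_def power2_eq_square[symmetric] power_divide
       del: real_sqrt_pow2_iff)
  have int: "integrable M (\<lambda>\<omega>. (transition_sum d n \<omega>)\<^sup>2)" for d n
    using integrable_history[of "\<lambda>h. (\<Sum>t<n. d (h t) (h (Suc t)))\<^sup>2" n] by (simp add: transition_sum_def)
  show "integrable M (\<lambda>\<omega>. (norm (score n \<omega>))\<^sup>2)" for n
    unfolding norm by (intro Bochner_Integration.integrable_sum integrable_divide int)
  show "expectation (\<lambda>\<omega>. (norm (score n \<omega>))\<^sup>2) \<le> (\<Sum>i\<in>(UNIV::'s set). \<Sum>j\<in>(UNIV::'s set). ?B\<^sup>2)" for n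
  proof -
    have "expectation (\<lambda>\<omega>. (norm (score n \<omega>))\<^sup>2) =
       (\<Sum>i\<in>UNIV. \<Sum>j\<in>UNIV. expectation (\<lambda>\<omega>. (transition_sum (deviation i j) n \<omega>)\<^sup>2) / real n)"
      unfolding norm by (simp add: int Bochner_Integration.integral_sum)
    also have "\<dots> \<le> (\<Sum>i\<in>(UNIV::'s set). \<Sum>j\<in>(UNIV::'s set). ?B\<^sup>2)"
    proof (intro sum_mono)
      fix i j
      show "expectation (\<lambda>\<omega>. (transition_sum (deviation i j) n \<omega>)\<^sup>2) / real n \<le> ?B\<^sup>2"
        using transition_sum_second_moment[OF centred_deviation B, of i j n] by (cases "n = 0") (simp_all add: divide_le_eq)
    qed
    finally show ?thesis .
  qed
qed simp

text \<open>The row-centred version of \<open>u\<close>; its transition sum is the linear functional \<open>u\<close> of the martingale array.\<close>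

definition contrast :: "real^'s^'s \<Rightarrow> 's \<Rightarrow> 's \<Rightarrow> real" where
  "contrast u x y = u $ x $ y - (\<Sum>j\<in>UNIV. P $ x $ j * u $ x $ j)"

lemma centred_contrast: "centred (contrast u)"
  by (simp add: centred_def contrast_def right_diff_distrib sum_subtractf sum_distrib_right[symmetric] P_sum)

lemma contrast_eq_sum: "contrast u x y = (\<Sum>i\<in>UNIV. \<Sum>j\<in>UNIV. u $ i $ j * deviation i j x y)"
proof -
  have "(\<Sum>j\<in>UNIV. u $ i $ j * deviation i j x y) = (if x = i then contrast u i y else 0)" for i
  proof -
    have "(\<Sum>j\<in>UNIV. u $ i $ j * of_bool (y = j)) = (\<Sum>j\<in>UNIV. if y = j then u $ i $ j else 0)"
      by (intro sum.cong) auto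
    then have "(\<Sum>j\<in>UNIV. u $ i $ j * of_bool (y = j)) = u $ i $ y" by simp
    then show ?thesis
      by (simp add: deviation_def contrast_def right_diff_distrib sum_subtractf mult.commute del: sum_mult_of_bool_eq)
  qed
  then show ?thesis by simp
qed

lemma inner_score: "u \<bullet> score n \<omega> = transition_sum (contrast u) n \<omega> / sqrt (real n)"
proof -
  have "transition_sum (contrast u) n \<omega> = (\<Sum>i\<in>UNIV. \<Sum>j\<in>UNIV. u $ i $ j * transition_sum (deviation i j) n \<omega>)"
    unfolding contrast_eq_sum[abs_def] by (simp only: transition_sum_sum transition_sum_scale)
  then show ?thesis by (simp add: inner_vec_def score_def sum_divide_distrib)
qed

end

context ergodic_chain begin

text \<open>Both sides are the sum over the rows \<open>i\<close>, with weights \<open>\<pi>\<^sub>i\<close>, of the variance of \<open>u\<^sub>i\<^sub>j\<close> when \<open>j\<close> has law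
  \<open>p\<^sub>i\<^sub>j\<close>. On the right, the factor \<open>\<pi>\<^sub>i\<^sup>2\<close> from the rescaling of \<open>u\<close> meets the factor \<open>\<pi>\<^sub>i\<^sup>-\<^sup>1\<close> of the covariance.\<close>

lemma asymp_variance_contrast:
  fixes u :: "real^'s^'s"
  defines "x \<equiv> vec_mat (transpose (scale_rows \<pi> u))"
  shows "asymp_variance (contrast u) = (x v* Sigma_p P \<pi>) \<bullet> x"
proof -
  define mean where "mean i = (\<Sum>j\<in>UNIV. P $ i $ j * u $ i $ j)" for i
  have lhs: "(\<Sum>j\<in>UNIV. P $ i $ j * (contrast u i j)\<^sup>2) = (\<Sum>j\<in>UNIV. P $ i $ j * (u $ i $ j)\<^sup>2) - (mean i)\<^sup>2" for i
  proof -
    have "(\<Sum>j\<in>UNIV. P $ i $ j * (contrast u i j)\<^sup>2) =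
       (\<Sum>j\<in>UNIV. P $ i $ j * (u $ i $ j)\<^sup>2 - 2 * mean i * (P $ i $ j * u $ i $ j) + (mean i)\<^sup>2 * P $ i $ j)"
      by (intro sum.cong refl) (simp add: contrast_def mean_def[symmetric] power2_eq_square algebra_simps)
    also have "\<dots> = (\<Sum>j\<in>UNIV. P $ i $ j * (u $ i $ j)\<^sup>2) - 2 * mean i * mean i + (mean i)\<^sup>2 * 1"
      unfolding sum.distrib sum_subtractf sum_distrib_left[symmetric] mean_def[symmetric] P_sum by simp
    finally show ?thesis by (simp add: power2_eq_square)
  qed
  have col: "(x v* Sigma_p P \<pi>) $ (i, l) = P $ i $ l * (u $ i $ l - mean i)" for i l
  proof -
    have "(x v* Sigma_p P \<pi>) $ (i, l) =
      (\<Sum>k\<in>UNIV. \<Sum>j\<in>UNIV. if k = i then u $ i $ j * (P $ i $ j * (of_bool (j = l) - P $ i $ l)) else 0)"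
      unfolding vector_matrix_mult_def sum_UNIV_prod vec_lambda_beta
      using \<pi>_pos[of i]
      by (intro sum.cong refl) (auto simp: x_def vec_mat_def transpose_def scale_rows_def Sigma_p_def Lambda_def)
    also have "\<dots> = (\<Sum>j\<in>UNIV. u $ i $ j * (P $ i $ j * (of_bool (j = l) - P $ i $ l)))"
      by (subst sum.swap) simp
    also have "\<dots> = (\<Sum>j\<in>UNIV. (if j = l then P $ i $ l * u $ i $ l else 0) - P $ i $ l * (P $ i $ j * u $ i $ j))"
      by (intro sum.cong refl) (simp add: algebra_simps)
    also have "\<dots> = P $ i $ l * u $ i $ l - P $ i $ l * mean i"
      by (simp add: sum_subtractf mean_def sum_distrib_left)
    finally show ?thesis by (simp add: algebra_simps)
  qed
  have "(x v* Sigma_p P \<pi>) \<bullet> x = (\<Sum>i\<in>UNIV. \<Sum>l\<in>UNIV. \<pi> $ i * (P $ i $ l * (u $ i $ l)\<^sup>2 - mean i * (P $ i $ l * u $ i $ l)))"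
    unfolding inner_vec_def sum_UNIV_prod col
    by (intro sum.cong refl) (simp add: x_def vec_mat_def transpose_def scale_rows_def power2_eq_square algebra_simps)
  also have "\<dots> = (\<Sum>i\<in>UNIV. \<pi> $ i * ((\<Sum>l\<in>UNIV. P $ i $ l * (u $ i $ l)\<^sup>2) - mean i * mean i))"
    unfolding sum_distrib_left[symmetric] sum_subtractf mean_def[symmetric] ..
  finally show ?thesis unfolding asymp_variance_def lhs by (simp add: power2_eq_square)
qed

text \<open>The score has limit law \<open>(\<pi>\<^sub>i W\<^sub>i\<^sub>j)\<close>; dividing its rows by the visit frequencies will produce \<open>W\<close>.\<close>

lemma score_cos_limit:
  assumes W: "is_W P \<pi> N W"
  shows "(\<lambda>n. \<integral>\<omega>. cos (u \<bullet> score n \<omega> + b) \<partial>M) \<longlonglongrightarrow> (\<integral>\<omega>. cos (u \<bullet> scale_rows \<pi> (W \<omega>) + b) \<partial>N)"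
proof -
  have "u \<bullet> scale_rows \<pi> w = scale_rows \<pi> u \<bullet> w" for w
    by (simp add: inner_vec_def scale_rows_def mult_ac)
  then have "(\<integral>\<omega>. cos (u \<bullet> scale_rows \<pi> (W \<omega>) + b) \<partial>N) = cos b * exp (- asymp_variance (contrast u) / 2)"
    by (simp add: W_cos[OF W] asymp_variance_contrast)
  then show ?thesis
    unfolding inner_score by (simp only: transition_sum_cos_limit[OF centred_contrast])
qed

lemma Gam_consistent:
  "AE \<omega> in M. limitin (powertop_real {..m}) (\<lambda>n. Gam m (P_hat X n \<omega>) a c) (Gam m P a c) sequentially"
  using P_hat_consistent
proof eventually_elim
  case (elim \<omega>)
  have "(\<lambda>n. (a v* matpow (P_hat X n \<omega>) k) \<bullet> c) \<longlonglongrightarrow> (a v* matpow P k) \<bullet> c" for k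
  proof -
    have "continuous_on UNIV (\<lambda>A. (a v* matpow A k) \<bullet> c)" by (intro continuous_intros)
    from continuous_on_tendsto_compose[OF this elim] show ?thesis by simp
  qed
  then show ?case
    by (simp add: limitin_componentwise Gam_def)
qed

text \<open>Once all states have been visited, the scaled error is \<open>delta_map\<close> of the
  pair \<open>A\<close> and the score. That happens almost surely from some time on, so the two have the same limit in law.\<close>

lemma Gam_limit_distribution:
  assumes W: "is_W P \<pi> N W"
  shows "conv_in_distribution {..m}
     M (\<lambda>n \<omega>. \<lambda>k\<in>{..m}. sqrt (real n) * (Gam m (P_hat X n \<omega>) a c k - Gam m P a c k))
     N (\<lambda>\<omega>. Z_vec m P a c (W \<omega>))"
  unfolding conv_in_distribution_def
proof (intro conjI allI impI)
  interpret N: prob_space N using W by (simp add: is_W_def gaussian_def)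
  have [measurable]: "W \<in> borel_measurable N" using W by (simp add: is_W_def gaussian_def)
  let ?T = "\<lambda>n \<omega>. \<lambda>k\<in>{..m}. sqrt (real n) * (Gam m (P_hat X n \<omega>) a c k - Gam m P a c k)"
  \<comment> \<open>Writing everything as a function of the finite trajectory settles measurability.\<close>
  define T' where "T' n h = (\<lambda>k\<in>{..m}. sqrt (real n) * (Gam m (P_hat (\<lambda>t h. h t) n h) a c k - Gam m P a c k))"
    for n and h :: "nat \<Rightarrow> 's"
  have T': "?T n \<omega> = T' n (history n \<omega>)" for n \<omega>
    by (simp add: T'_def P_hat_history)
  show "?T n \<in> measurable M (\<Pi>\<^sub>M i\<in>{..m}. borel)" for n
  proof (rule measurable_restrict)
    fix k
    show "(\<lambda>\<omega>. sqrt (real n) * (Gam m (P_hat X n \<omega>) a c k - Gam m P a c k)) \<in> borel_measurable M"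
      unfolding P_hat_history by (rule borel_measurable_integrable[OF integrable_history])
  qed
  show "(\<lambda>\<omega>. Z_vec m P a c (W \<omega>)) \<in> measurable N (\<Pi>\<^sub>M i\<in>{..m}. borel)"
    unfolding Z_vec_def
  proof (rule measurable_restrict)
    fix k
    have "continuous_on UNIV (\<lambda>w. (a v* W_pow P w k) \<bullet> c)"
      unfolding W_pow_def by (intro continuous_intros)
    then have [measurable]: "(\<lambda>w. (a v* W_pow P w k) \<bullet> c) \<in> borel_measurable borel"
      by (rule borel_measurable_continuous_onI)
    show "(\<lambda>\<omega>. (a v* W_pow P (W \<omega>) k) \<bullet> c) \<in> borel_measurable N" by measurable
  qed
  fix f :: "(nat \<Rightarrow> real) \<Rightarrow> real"
  assume f: "continuous_map (powertop_real {..m}) euclideanreal f \<and> bounded (f ` topspace (powertop_real {..m}))"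
  then obtain B where B: "\<And>x. x \<in> extensional {..m} \<Longrightarrow> \<bar>f x\<bar> \<le> B"
    by (auto simp: bounded_iff PiE_def)
  define H where "H q V = f (delta_map m P a c q V)" for q V
  have H: "continuous_on UNIV (\<lambda>(q, V). H q V)"
    using continuous_map_compose[OF delta_map_continuous f[THEN conjunct1]]
    by (simp add: H_def o_def case_prod_beta)
  have HB: "\<bar>H q V\<bar> \<le> B" for q V
    unfolding H_def by (rule B) (simp add: delta_map_def split: prod.split)
  define A where "A n \<omega> = (P_hat X n \<omega>, \<chi> i. real n / real (visit_count X n \<omega> i))" for n \<omega>
  define A' where "A' n h = (P_hat (\<lambda>t h. h t) n h, (\<chi> i. real n / real (visit_count (\<lambda>t h. h t) n h i)) :: real^'s)"
    for n and h :: "nat \<Rightarrow> 's"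
  have A': "A n \<omega> = A' n (history n \<omega>)" for n \<omega>
    by (simp add: A_def A'_def P_hat_history visit_count_history)
  have A_meas: "A n \<in> borel_measurable M" for n
    using borel_measurable_integrable[OF integrable_history[of "A' n" n]] by (simp add: A'[symmetric])
  have A_lim: "AE \<omega> in M. (\<lambda>n. A n \<omega>) \<longlonglongrightarrow> (P, \<chi> i. inverse (\<pi> $ i))"
    using P_hat_consistent inverse_visit_frequency
    unfolding A_def by eventually_elim (rule tendsto_Pair)
  have G_meas: "(\<lambda>\<omega>. scale_rows \<pi> (W \<omega>)) \<in> borel_measurable N"
  proof -
    have "continuous_on UNIV (scale_rows \<pi>)"
      unfolding scale_rows_def[abs_def] by (intro continuous_intros continuous_on_vec_lambda continuous_on_component)
    then have "scale_rows \<pi> \<in> borel_measurable borel" by (rule borel_measurable_continuous_onI)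
    then show ?thesis by (rule measurable_compose[OF \<open>W \<in> borel_measurable N\<close>])
  qed
  have weak: "(\<lambda>n. \<integral>\<omega>. g (score n \<omega>) \<partial>M) \<longlonglongrightarrow> (\<integral>\<omega>. g (scale_rows \<pi> (W \<omega>)) \<partial>N)"
    if "continuous_on UNIV g" "\<And>x. \<bar>g x\<bar> \<le> C" for g :: "real^'s^'s \<Rightarrow> real" and C
    by (rule levy_cramer_wold[OF prob_space_axioms N.prob_space_axioms score_measurable G_meas score_tight
          score_cos_limit[OF W] that])
  have main: "(\<lambda>n. \<integral>\<omega>. H (A n \<omega>) (score n \<omega>) \<partial>M) \<longlonglongrightarrow> (\<integral>\<omega>. f (Z_vec m P a c (W \<omega>)) \<partial>N)"
  proof -
    have "(\<lambda>n. \<integral>\<omega>. H (A n \<omega>) (score n \<omega>) \<partial>M) \<longlonglongrightarrow>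
        (\<integral>\<omega>. H (P, \<chi> i. inverse (\<pi> $ i)) (scale_rows \<pi> (W \<omega>)) \<partial>N)"
      by (rule slutsky[OF prob_space_axioms score_measurable A_meas score_tight weak A_lim H HB])
    moreover have "\<pi> $ i \<noteq> 0" for i using \<pi>_pos[of i] by simp
    ultimately show ?thesis by (simp add: H_def Z_vec_eq_delta_map[symmetric])
  qed
  have fT_meas: "(\<lambda>\<omega>. f (?T n \<omega>)) \<in> borel_measurable M" for n
    unfolding T' by (rule borel_measurable_integrable[OF integrable_history])
  have H_meas: "(\<lambda>\<omega>. H (A n \<omega>) (score n \<omega>)) \<in> borel_measurable M" for n
    using borel_measurable_continuous_Pair[OF A_meas score_measurable H[unfolded case_prod_beta]] by simp
  have fT_bound: "\<bar>f (?T n \<omega>)\<bar> \<le> B" for n \<omega> by (rule B) simp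
  have "(\<lambda>n. \<integral>\<omega>. f (?T n \<omega>) - H (A n \<omega>) (score n \<omega>) \<partial>M) \<longlonglongrightarrow> (\<integral>\<omega>. 0 \<partial>M)"
  proof (rule integral_dominated_convergence[where w="\<lambda>_. B + B"])
    show "AE \<omega> in M. (\<lambda>n. f (?T n \<omega>) - H (A n \<omega>) (score n \<omega>)) \<longlonglongrightarrow> 0"
      using eventually_all_visited
    proof eventually_elim
      case (elim \<omega>)
      have "\<forall>\<^sub>F n in sequentially. f (?T n \<omega>) - H (A n \<omega>) (score n \<omega>) = 0"
        using elim eventually_gt_at_top[of 0]
      proof eventually_elim
        case (elim n)
        then have "?T n \<omega> = delta_map m P a c (A n \<omega>) (score n \<omega>)"
          unfolding A_def by (intro Gam_error score_eq_P_hat_error) auto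
        then show ?case by (simp only: H_def)
      qed
      then show ?case by (rule tendsto_eventually)
    qed
    show "AE \<omega> in M. norm (f (?T n \<omega>) - H (A n \<omega>) (score n \<omega>)) \<le> B + B" for n
      by (intro AE_I2 order_trans[OF norm_triangle_ineq4]) (simp only: real_norm_def, intro add_mono fT_bound HB)
  qed (use fT_meas H_meas in simp_all)
  moreover have "(\<integral>\<omega>. f (?T n \<omega>) - H (A n \<omega>) (score n \<omega>) \<partial>M) =
      (\<integral>\<omega>. f (?T n \<omega>) \<partial>M) - (\<integral>\<omega>. H (A n \<omega>) (score n \<omega>) \<partial>M)" for n
    by (intro Bochner_Integration.integral_diff integrable_const_bound[where B=B] AE_I2 fT_meas H_meas)
       (simp_all only: real_norm_def fT_bound HB)
  ultimately have "(\<lambda>n. (\<integral>\<omega>. f (?T n \<omega>) \<partial>M) - (\<integral>\<omega>. H (A n \<omega>) (score n \<omega>) \<partial>M)) \<longlonglongrightarrow> 0" by simp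
  from tendsto_add[OF this main]
  show "(\<lambda>n. \<integral>\<omega>. f (?T n \<omega>) \<partial>M) \<longlonglongrightarrow> (\<integral>\<omega>. f (Z_vec m P a c (W \<omega>)) \<partial>N)" by simp
qed

end

theorem proposition5:
  fixes P :: "real^'s^'s"
    and \<pi> a c :: "real^'s"
    and M :: "'a measure" and X :: "nat \<Rightarrow> 'a \<Rightarrow> 's"
    and N :: "'b measure" and W :: "'b \<Rightarrow> real^'s^'s"
    and m :: nat
  assumes "stochastic P" and "irreducible_mat P"
    and "stationary P \<pi>"
    and "markov_chain M X P"
    and "is_W P \<pi> N W"
    and "prob_vector a"
  shows "(AE \<omega> in M. limitin (powertop_real {..m})
           (\<lambda>n. Gam m (P_hat X n \<omega>) a c) (Gam m P a c) sequentially) \<and>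
         conv_in_distribution {..m}
           M (\<lambda>n \<omega>. \<lambda>k\<in>{..m}. sqrt (real n) * (Gam m (P_hat X n \<omega>) a c k - Gam m P a c k))
           N (\<lambda>\<omega>. Z_vec m P a c (W \<omega>)) \<and>
         (\<forall>k\<le>m. \<forall>l\<le>m.
           covariance N (\<lambda>\<omega>. Z_vec m P a c (W \<omega>) k) (\<lambda>\<omega>. Z_vec m P a c (W \<omega>) l) =
           (kron_vec a c v* (M_mat P k ** Sigma_p P \<pi> ** transpose (M_mat P l))) \<bullet> kron_vec a c)"
proof -
  interpret ergodic_chain M X P \<pi>
    by unfold_locales (fact assms)+
  show ?thesis
    using Gam_consistent Gam_limit_distribution[OF assms(5)] Z_vec_covariance[OF assms(5)] by blast
qed

end
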